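(* Let $d\ge1$ and let $P\subset\mathbb{R}^d$ be a generic orthotope of dimension $d$. The 1-dimensional skeleton of $P$, i.e. the graph whose vertices are the vertices ($0$-dimensional faces) of $P$ and whose edges are the $1$-dimensional faces of $P$ (each joining the vertices of $P$ which are its endpoints), is a bipartite graph in which every vertex has degree $d$.
   Context: **Floral vertices.** A series-parallel diagram (SPD) $\Delta$ with finite nonempty edge set $E$ is either a single edge, or a series connection $\Delta_1\wedge\Delta_2$, or a parallel connection $\Delta_1\vee\Delta_2$, of SPDs with disjoint nonempty edge sets whose union is $E$ (a read-once formula in $\wedge,\vee$). A signed SPD is a pair $(\Delta,s)$ with $s:E\to\{\pm1\}$. Let $H_i=\{x\in\mathbb{R}^d: x_i\ge 0\}$. If $E=\{1,\dots,d\}$, the floral vertex in $\mathbb{R}^d$ determined by $(\Delta,s)$ is the set obtained by interpreting edge $i$ as $s_iH_i$, series connection as intersection and parallel connection as union. **Orthogonal polytopes.** An axis-aligned box is a product $\prod_{i=1}^d[a_i,b_i]$, $a_i\le b_i$; it is pure $d$-dimensional if all $a_i<b_i$. A pure $d$-dimensional orthogonal polytope is a finite (possibly empty) union of pure $d$-dimensional boxes. For $s\in\{\pm1\}^d$ the orthant $\Omega_s$ is $\{x: s_ix_i\ge0\ \forall i\}$; a local orthotopal arrangement is a union of orthants. The tangent cone of $P$ at $v\in P$ is the local orthotopal arrangement $\alpha$ such that for some $\delta>0$, $P\cap(v+[-\delta,\delta]^d)=v+(\alpha\cap[-\delta,\delta]^d)$. The genericity region of $v\in P$ is the set of points of $P$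 joined to $v$ by a path in $P$ along which every tangent cone is congruent (under signed coordinate permutations) to the one at $v$. Its degree is the smallest dimension of a set of the form $\{x:x_i=\lambda_i\ \forall i\in I\}$ ($I\subset\{1,\dots,d\}$) containing it. A point is singular, or a vertex of $P$, if its genericity region has degree $0$. A $k$-dimensional face of $P$ is the closure of a genericity region of degree $k$. **Generic orthotope.** A generic orthotope of dimension $d$ is a pure $d$-dimensional orthogonal polytope in $\mathbb{R}^d$ such that the tangent cone at every singular point is a floral vertex in $\mathbb{R}^d$. *)

theory Defs
  imports "HOL-Analysis.Analysis"
begin

section \<open>Series-parallel diagrams and floral vertices\<close>

datatype (spd_edges: 'e) spd =
    Edge 'e
  | Series "'e spd" "'e spd"
  | Parallel "'e spd" "'e spd"

text \<open>
  The datatype only provides terms; an SPD is a term in which the two parts of every series or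
  parallel connection have disjoint edge sets.
\<close>

fun is_spd :: "'e spd \<Rightarrow> bool" where
  "is_spd (Edge e) \<longleftrightarrow> True"
| "is_spd (Series D1 D2) \<longleftrightarrow> is_spd D1 \<and> is_spd D2 \<and> spd_edges D1 \<inter> spd_edges D2 = {}"
| "is_spd (Parallel D1 D2) \<longleftrightarrow> is_spd D1 \<and> is_spd D2 \<and> spd_edges D1 \<inter> spd_edges D2 = {}"

fun spd_interp :: "('e \<Rightarrow> 'a set) \<Rightarrow> 'e spd \<Rightarrow> 'a set" where
  "spd_interp h (Edge e) = h e"
| "spd_interp h (Series D1 D2) = spd_interp h D1 \<inter> spd_interp h D2"
| "spd_interp h (Parallel D1 D2) = spd_interp h D1 \<union> spd_interp h D2"

definition is_sign :: "('e \<Rightarrow> real) \<Rightarrow> bool" where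
  "is_sign s \<longleftrightarrow> (\<forall>i. s i \<in> {1, -1})"

definition pos_halfspace :: "'n \<Rightarrow> (real^'n) set" where
  "pos_halfspace i = {x. 0 \<le> x $ i}"

definition floral :: "'n spd \<Rightarrow> ('n \<Rightarrow> real) \<Rightarrow> (real^'n) set" where
  "floral D s = spd_interp (\<lambda>i. (\<lambda>x. s i *\<^sub>R x) ` pos_halfspace i) D"

definition floral_vertex :: "(real^'n) set \<Rightarrow> bool" where
  "floral_vertex A \<longleftrightarrow>
     (\<exists>D s. is_spd D \<and> spd_edges D = UNIV \<and> is_sign s \<and> A = floral D s)"


section \<open>Orthogonal polytopes and tangent cones\<close>

definition pure_box :: "(real^'n) set \<Rightarrow> bool" where
  "pure_box B \<longleftrightarrow> (\<exists>a b. (\<forall>i. a $ i < b $ i) \<and> B = cbox a b)"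

definition orthogonal_polytope :: "(real^'n) set \<Rightarrow> bool" where
  "orthogonal_polytope P \<longleftrightarrow> (\<exists>\<B>. finite \<B> \<and> (\<forall>B\<in>\<B>. pure_box B) \<and> P = \<Union>\<B>)"

definition orthant :: "('n \<Rightarrow> real) \<Rightarrow> (real^'n) set" where
  "orthant s = {x. \<forall>i. 0 \<le> s i * x $ i}"

definition local_arrangement :: "(real^'n) set \<Rightarrow> bool" where
  "local_arrangement A \<longleftrightarrow> (\<exists>S. (\<forall>s\<in>S. is_sign s) \<and> A = (\<Union>s\<in>S. orthant s))"

definition cube :: "real \<Rightarrow> (real^'n) set" where
  "cube r = cbox (\<chi> i. - r) (\<chi> i. r)"

definition is_tangent_cone :: "(real^'n) set \<Rightarrow> real^'n \<Rightarrow> (real^'n) set \<Rightarrow> bool" where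
  "is_tangent_cone P v A \<longleftrightarrow>
     local_arrangement A \<and> (\<exists>r>0. P \<inter> (+) v ` cube r = (+) v ` (A \<inter> cube r))"

text \<open>
  Local arrangements are invariant under positive scaling, so at most one of them satisfies
  \<^const>\<open>is_tangent_cone\<close> at a given point; for an orthogonal polytope one always does.
\<close>

definition tangent_cone :: "(real^'n) set \<Rightarrow> real^'n \<Rightarrow> (real^'n) set" where
  "tangent_cone P v = (THE A. is_tangent_cone P v A)"

text \<open>Congruence under signed coordinate permutations.\<close>

definition congruent_cones :: "(real^'n) set \<Rightarrow> (real^'n) set \<Rightarrow> bool" where
  "congruent_cones A B \<longleftrightarrow>
     (\<exists>p s. bij p \<and> is_sign s \<and> B = (\<lambda>x. \<chi> i. s i * x $ p i) ` A)"


section \<open>Genericity regions and faces\<close>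

definition genericity_region :: "(real^'n) set \<Rightarrow> real^'n \<Rightarrow> (real^'n) set" where
  "genericity_region P v =
     {w \<in> P. \<exists>g. path g \<and> path_image g \<subseteq> P \<and> pathstart g = v \<and> pathfinish g = w \<and>
        (\<forall>u\<in>path_image g. congruent_cones (tangent_cone P u) (tangent_cone P v))}"

definition coord_flat :: "'n set \<Rightarrow> ('n \<Rightarrow> real) \<Rightarrow> (real^'n) set" where
  "coord_flat I c = {x. \<forall>i\<in>I. x $ i = c i}"

definition region_degree :: "(real^'n) set \<Rightarrow> nat" where
  "region_degree S = (LEAST k. \<exists>I c. S \<subseteq> coord_flat I c \<and> aff_dim (coord_flat I c) = int k)"

definition vertices :: "(real^'n) set \<Rightarrow> (real^'n) set" where
  "vertices P = {v \<in> P. region_degree (genericity_region P v) = 0}"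

definition faces :: "nat \<Rightarrow> (real^'n) set \<Rightarrow> (real^'n) set set" where
  "faces k P =
     {closure (genericity_region P v) | v. v \<in> P \<and> region_degree (genericity_region P v) = k}"

definition generic_orthotope :: "(real^'n) set \<Rightarrow> bool" where
  "generic_orthotope P \<longleftrightarrow>
     orthogonal_polytope P \<and> (\<forall>v\<in>vertices P. floral_vertex (tangent_cone P v))"


section \<open>Graphs\<close>

text \<open>
  A graph is given by a vertex set \<open>V\<close>, a set \<open>E\<close> of abstract edges (below, one-dimensional
  faces) and a map \<open>ends\<close> sending each edge to the set of the two vertices that it joins.
\<close>

definition simple_graph :: "'v set \<Rightarrow> 'e set \<Rightarrow> ('e \<Rightarrow> 'v set) \<Rightarrow> bool" where
  "simple_graph V E ends \<longleftrightarrow> (\<forall>e\<in>E. ends e \<subseteq> V \<and> card (ends e) = 2) \<and> inj_on ends E"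

definition bipartite :: "'v set \<Rightarrow> 'e set \<Rightarrow> ('e \<Rightarrow> 'v set) \<Rightarrow> bool" where
  "bipartite V E ends \<longleftrightarrow>
     (\<exists>A B. A \<union> B = V \<and> A \<inter> B = {} \<and> (\<forall>e\<in>E. \<exists>a\<in>A. \<exists>b\<in>B. ends e = {a, b}))"

definition vertex_degree :: "'e set \<Rightarrow> ('e \<Rightarrow> 'v set) \<Rightarrow> 'v \<Rightarrow> nat" where
  "vertex_degree E ends v = card {e \<in> E. v \<in> ends e}"

text \<open>
  Endpoints of a nondegenerate segment. The value is empty on sets that are not of this form, so
  \<^const>\<open>simple_graph\<close> with \<open>ends = endpoints\<close> includes the assertion that every edge is a segment.
\<close>

definition endpoints :: "(real^'n) set \<Rightarrow> (real^'n) set" where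
  "endpoints F = {a. \<exists>b. a \<noteq> b \<and> F = closed_segment a b}"

end

theory Submission
  imports Defs
begin

text \<open>
  The tangent cone at a point is encoded by its germ, the set of sign vectors whose orthants it
  contains. Moving from \<open>v\<close> a little in direction \<open>y\<close> overrides the signs on the support of \<open>y\<close>, so
  the number of inessential coordinates (those whose flip preserves the germ) can only grow, and
  it stays the same only if the germ does. Hence congruent cones along a path force equal germs,
  genericity regions are path components of level sets of the germ, and their degree is the
  number of inessential coordinates. A region of degree 1 is an open segment bounded by vertices.

  For a set \<open>S\<close> of sign vectors put \<open>\<chi>(S) = \<Sum>t\<in>S. \<Prod>i. t i\<close>. It vanishes as soon as some coordinate is
  inessential, while for a read-once formula it is \<open>\<plusminus>1\<close>: it is multiplicative for series, and up to
  sign for parallel connections. Fixing the sign of coordinate \<open>i\<close> in a read-once formula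
  contributes to \<open>\<chi>\<close> for exactly one of the two values, since the other one trivialises the sibling
  of \<open>i\<close>. So each coordinate carries exactly one edge at each vertex, and the two ends of an edge,
  which see the same link from opposite sides, have opposite \<open>\<chi>\<close>.
\<close>

section \<open>Sign vectors and local arrangements\<close>

abbreviation sign_vec :: "('n \<Rightarrow> real) \<Rightarrow> real^'n" where
  "sign_vec t \<equiv> (\<chi> i. t i)"

definition arrangement :: "('n \<Rightarrow> real) set \<Rightarrow> (real^'n) set" where
  "arrangement S = (\<Union>s\<in>S. orthant s)"

lemma is_sign_cases: "is_sign t \<Longrightarrow> t i = 1 \<or> t i = -1"
  by (auto simp: is_sign_def)

lemma is_sign_upd: "is_sign t \<Longrightarrow> e = 1 \<or> e = -1 \<Longrightarrow> is_sign (t(i := e))"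
  by (auto simp: is_sign_def)

lemma finite_signs: "finite {t :: 'n::finite \<Rightarrow> real. is_sign t}"
proof -
  have "{t :: 'n \<Rightarrow> real. is_sign t} = PiE UNIV (\<lambda>_. {1, -1})"
    by (auto simp: is_sign_def PiE_def Pi_def)
  then show ?thesis by (simp add: finite_PiE)
qed

lemma sign_vec_in_orthant:
  assumes "is_sign s" "is_sign t"
  shows "sign_vec t \<in> orthant s \<longleftrightarrow> s = t"
proof
  assume h: "sign_vec t \<in> orthant s"
  have "s i = t i" for i
    using h is_sign_cases[OF assms(1), of i] is_sign_cases[OF assms(2), of i]
    by (auto simp: orthant_def dest: spec[of _ i])
  then show "s = t" by auto
next
  assume "s = t"
  then show "sign_vec t \<in> orthant s" by (simp add: orthant_def)
qed

lemma sign_vec_in_arrangement: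
  assumes "S \<subseteq> {s. is_sign s}" "is_sign t"
  shows "sign_vec t \<in> arrangement S \<longleftrightarrow> t \<in> S"
  using assms sign_vec_in_orthant by (fastforce simp: arrangement_def)

lemma scaleR_in_arrangement:
  assumes "0 < c"
  shows "c *\<^sub>R x \<in> arrangement S \<longleftrightarrow> x \<in> arrangement S"
proof -
  have "0 \<le> s i * (c * x $ i) \<longleftrightarrow> 0 \<le> s i * x $ i" for s :: "'a \<Rightarrow> real" and i
    using assms by (metis mult.left_commute zero_le_mult_iff less_le_not_le)
  then show ?thesis by (simp add: arrangement_def orthant_def)
qed

lemma zero_in_arrangement: "0 \<in> arrangement S \<longleftrightarrow> S \<noteq> {}"
  by (auto simp: arrangement_def orthant_def)

section \<open>Existence and uniqueness of tangent cones\<close>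

lemma uniform_lower_bound:
  fixes f :: "'n::finite \<Rightarrow> real"
  assumes "\<And>i. 0 < f i"
  shows "\<exists>r>0. \<forall>i. r < f i"
proof -
  have "0 < Min (range f)" using assms by simp
  then obtain r where "0 < r" "r < Min (range f)" using dense by blast
  moreover have "Min (range f) \<le> f i" for i by simp
  ultimately show ?thesis by (metis order_less_le_trans)
qed

text \<open>The cube condition of \<open>is_tangent_cone\<close>, read pointwise in displacements
  from v. Set and radius are both explicit, so that forms can be shrunk, compared and united. Points
  outside P are allowed: for an orthogonal polytope they get \<open>S = {}\<close>.\<close>

definition local_form ::
    "(real^'n) set \<Rightarrow> real^'n \<Rightarrow> ('n \<Rightarrow> real) set \<Rightarrow> real \<Rightarrow> bool" where
  "local_form P v S r \<longleftrightarrow> 0 < r \<and> S \<subseteq> {s. is_sign s} \<and>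
     (\<forall>x. (\<forall>i. \<bar>x $ i\<bar> \<le> r) \<longrightarrow> (v + x \<in> P \<longleftrightarrow> x \<in> arrangement S))"

lemma mem_cube: "x \<in> cube r \<longleftrightarrow> (\<forall>i. \<bar>x $ i\<bar> \<le> r)"
proof -
  have "(- r \<le> x $ i \<and> x $ i \<le> r) \<longleftrightarrow> \<bar>x $ i\<bar> \<le> r" for i by linarith
  then show ?thesis by (simp add: cube_def mem_box_cart)
qed

lemma is_tangent_cone_iff:
  "is_tangent_cone P v A \<longleftrightarrow> (\<exists>S r. local_form P v S r \<and> A = arrangement S)"
proof -
  have eq: "P \<inter> (+) v ` cube r = (+) v ` (A \<inter> cube r) \<longleftrightarrow>
      (\<forall>x. (\<forall>i. \<bar>x $ i\<bar> \<le> r) \<longrightarrow> (v + x \<in> P \<longleftrightarrow> x \<in> A))" for r A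
    unfolding mem_cube[symmetric]
  proof -
    have "(P \<inter> (+) v ` cube r = (+) v ` (A \<inter> cube r)) \<longleftrightarrow>
        (+) v -` (P \<inter> (+) v ` cube r) = (+) v -` ((+) v ` (A \<inter> cube r))"
      by (metis surj_plus image_vimage_eq inf_top_right)
    also have "\<dots> \<longleftrightarrow> (\<forall>x. v + x \<in> P \<and> x \<in> cube r \<longleftrightarrow> x \<in> A \<and> x \<in> cube r)"
      by (auto simp: set_eq_iff image_iff)
    finally show "(P \<inter> (+) v ` cube r = (+) v ` (A \<inter> cube r)) \<longleftrightarrow>
        (\<forall>x. x \<in> cube r \<longrightarrow> (v + x \<in> P \<longleftrightarrow> x \<in> A))" by blast
  qed
  show ?thesis
    unfolding is_tangent_cone_def local_arrangement_def local_form_def eq arrangement_def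
    by blast
qed

lemma local_form_mono:
  assumes "local_form P v S r" "0 < r'" "r' \<le> r"
  shows "local_form P v S r'"
  using assms by (auto simp: local_form_def intro: order_trans)

text \<open>A sign vector lies in its own orthant and in no other, so the corners of a common small
  cube read off S one element at a time.\<close>

lemma local_form_unique:
  assumes "local_form P v S r" "local_form P v S' r'"
  shows "S = S'"
proof -
  define q where "q = min r r'"
  have q: "0 < q" "q \<le> r" "q \<le> r'" using assms by (auto simp: q_def local_form_def)
  have "t \<in> S \<longleftrightarrow> t \<in> S'" if t: "is_sign t" for t
  proof -
    have b: "\<bar>(q *\<^sub>R sign_vec t) $ i\<bar> \<le> q" for i
      using is_sign_cases[OF t, of i] q by auto
    have "v + q *\<^sub>R sign_vec t \<in> P \<longleftrightarrow> t \<in> S"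
      using local_form_mono[OF assms(1) q(1,2)] b sign_vec_in_arrangement t
        scaleR_in_arrangement[OF q(1)]
      unfolding local_form_def by blast
    moreover have "v + q *\<^sub>R sign_vec t \<in> P \<longleftrightarrow> t \<in> S'"
      using local_form_mono[OF assms(2) q(1,3)] b sign_vec_in_arrangement t
        scaleR_in_arrangement[OF q(1)]
      unfolding local_form_def by blast
    ultimately show ?thesis by simp
  qed
  then show ?thesis using assms by (auto simp: local_form_def)
qed

text \<open>With r below the distance to every endpoint other than v, membership is constant on each
  side of v and can be tested at v + r or v - r. Since a < b, a point v of the interval has at least
  one whole side inside; for a = b = v the equivalence would fail at x = 0.\<close>

lemma interval_local_form:
  fixes a b v r x :: real
  assumes "a < b" "0 < r" "v \<noteq> a \<Longrightarrow> r < \<bar>v - a\<bar>" "v \<noteq> b \<Longrightarrow> r < \<bar>v - b\<bar>" "\<bar>x\<bar> \<le> r"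
  shows "a \<le> v + x \<and> v + x \<le> b \<longleftrightarrow>
    (\<exists>s. (s = 1 \<or> s = -1) \<and> a \<le> v + r * s \<and> v + r * s \<le> b \<and> 0 \<le> s * x)"
proof
  assume "a \<le> v + x \<and> v + x \<le> b"
  then have "(a \<le> v + r * 1 \<and> v + r * 1 \<le> b \<and> 0 \<le> 1 * x) \<or>
     (a \<le> v + r * (-1) \<and> v + r * (-1) \<le> b \<and> 0 \<le> (-1) * x)"
    using assms by argo
  then show "\<exists>s. (s = 1 \<or> s = -1) \<and> a \<le> v + r * s \<and> v + r * s \<le> b \<and> 0 \<le> s * x"
    by blast
next
  assume "\<exists>s. (s = 1 \<or> s = -1) \<and> a \<le> v + r * s \<and> v + r * s \<le> b \<and> 0 \<le> s * x"
  then obtain s where "s = 1 \<or> s = -1" "a \<le> v + r * s" "v + r * s \<le> b" "0 \<le> s * x" by blast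
  then show "a \<le> v + x \<and> v + x \<le> b" using assms by (elim disjE) (simp_all, argo+)
qed

lemma pure_box_local_form:
  assumes "pure_box B"
  shows "\<exists>S r. local_form B v S r"
proof -
  from assms obtain a b where ab: "\<And>i. a $ i < b $ i" and B: "B = cbox a b"
    by (auto simp: pure_box_def)
  \<comment> \<open>The value 1 is a dummy: a wall passing through v puts no bound on the
    radius.\<close>
  define f where "f i = min (if v $ i = a $ i then 1 else \<bar>v $ i - a $ i\<bar>)
      (if v $ i = b $ i then 1 else \<bar>v $ i - b $ i\<bar>)" for i
  have "0 < f i" for i by (simp add: f_def)
  then obtain r where r: "0 < r" "\<And>i. r < f i" using uniform_lower_bound by metis
  have ra: "r < \<bar>v $ i - a $ i\<bar>" if "v $ i \<noteq> a $ i" for i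
    using r(2)[of i] that by (simp add: f_def)
  have rb: "r < \<bar>v $ i - b $ i\<bar>" if "v $ i \<noteq> b $ i" for i
    using r(2)[of i] that by (simp add: f_def)
  \<comment> \<open>A box is a product, so the admissible sides are chosen independently in each
    coordinate. The set S therefore consists of the corners of the cube of radius r around v that
    lie in B, and \<open>choice_iff\<close> assembles the coordinatewise signs into one sign
    vector.\<close>
  define S where "S = {s. is_sign s \<and> (\<forall>i. a $ i \<le> v $ i + r * s i \<and> v $ i + r * s i \<le> b $ i)}"
  have "v + x \<in> B \<longleftrightarrow> x \<in> arrangement S" if x: "\<forall>i. \<bar>x $ i\<bar> \<le> r" for x
  proof -
    have "v + x \<in> B \<longleftrightarrow> (\<forall>i. \<exists>s. (s = 1 \<or> s = -1) \<and> a $ i \<le> v $ i + r * s \<and>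
        v $ i + r * s \<le> b $ i \<and> 0 \<le> s * x $ i)"
    proof -
      have "a $ i \<le> v $ i + x $ i \<and> v $ i + x $ i \<le> b $ i \<longleftrightarrow>
        (\<exists>s. (s = 1 \<or> s = -1) \<and> a $ i \<le> v $ i + r * s \<and>
        v $ i + r * s \<le> b $ i \<and> 0 \<le> s * x $ i)" for i
        using ab[of i] r(1) ra[of i] rb[of i] x by (intro interval_local_form) auto
      then show ?thesis by (simp add: B mem_box_cart)
    qed
    also have "\<dots> \<longleftrightarrow> x \<in> arrangement S"
      by (subst choice_iff) (auto simp: S_def arrangement_def orthant_def is_sign_def)
    finally show ?thesis .
  qed
  then have "local_form B v S r" using r(1) by (auto simp: local_form_def S_def)
  then show ?thesis by blast
qed

lemma local_form_Un:
  assumes "local_form P v S r" "local_form Q v T q"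
  shows "local_form (P \<union> Q) v (S \<union> T) (min r q)"
  using assms by (auto simp: local_form_def arrangement_def)

lemma orthogonal_polytope_local_form:
  assumes "orthogonal_polytope P"
  shows "\<exists>S r. local_form P v S r"
proof -
  from assms obtain \<B> where B: "finite \<B>" "\<forall>B\<in>\<B>. pure_box B" and P: "P = \<Union>\<B>"
    by (auto simp: orthogonal_polytope_def)
  from B have "\<exists>S r. local_form (\<Union>\<B>) v S r"
  proof (induction rule: finite_induct)
    case empty
    have "local_form {} v {} 1" by (simp add: local_form_def arrangement_def)
    then show ?case by (metis Union_empty)
  next
    case (insert B \<B>)
    obtain S r where "local_form B v S r" using pure_box_local_form insert.prems by blast
    moreover obtain T q where "local_form (\<Union>\<B>) v T q" using insert by auto
    ultimately show ?case using local_form_Un by (metis Union_insert)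
  qed
  then show ?thesis by (simp add: P)
qed

lemma orthogonal_polytope_compact: "orthogonal_polytope P \<Longrightarrow> compact P"
  by (auto simp: orthogonal_polytope_def pure_box_def intro!: compact_Union)

section \<open>Germs and their change under small displacements\<close>

definition germ :: "(real^'n) set \<Rightarrow> real^'n \<Rightarrow> ('n \<Rightarrow> real) set" where
  "germ P v = {t. is_sign t \<and> sign_vec t \<in> tangent_cone P v}"

lemma tangent_cone_local_form:
  assumes "local_form P v S r"
  shows "tangent_cone P v = arrangement S"
  unfolding tangent_cone_def
proof (rule the_equality)
  show "is_tangent_cone P v (arrangement S)" using assms is_tangent_cone_iff by blast
  show "A = arrangement S" if "is_tangent_cone P v A" for A
    using that local_form_unique[OF assms] by (auto simp: is_tangent_cone_iff)
qed

lemma germ_local_form: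
  assumes "local_form P v S r"
  shows "germ P v = S"
  using assms sign_vec_in_arrangement
  by (auto simp: germ_def tangent_cone_local_form[OF assms] local_form_def)

lemma germ_is_sign: "t \<in> germ P v \<Longrightarrow> is_sign t"
  by (simp add: germ_def)

lemma tangent_cone_germ:
  assumes "orthogonal_polytope P"
  shows "tangent_cone P v = arrangement (germ P v)"
  using orthogonal_polytope_local_form[OF assms, of v] germ_local_form tangent_cone_local_form
  by metis

text \<open>The zero displacement lies in every orthant, so a single orthant in the germ already
  puts v into P.\<close>

lemma germ_empty_iff:
  assumes "orthogonal_polytope P"
  shows "germ P v = {} \<longleftrightarrow> v \<notin> P"
proof -
  obtain r where "local_form P v (germ P v) r"
    using orthogonal_polytope_local_form[OF assms, of v] germ_local_form by metis
  then have "v + 0 \<in> P \<longleftrightarrow> 0 \<in> arrangement (germ P v)"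
    unfolding local_form_def by (metis abs_zero less_imp_le zero_index)
  then show ?thesis by (simp add: zero_in_arrangement)
qed

definition override_signs :: "real^'n \<Rightarrow> ('n \<Rightarrow> real) \<Rightarrow> 'n \<Rightarrow> real" where
  "override_signs y t = (\<lambda>i. if y $ i = 0 then t i else sgn (y $ i))"

lemma is_sign_override: "is_sign t \<Longrightarrow> is_sign (override_signs y t)"
  by (auto simp: is_sign_def override_signs_def sgn_if)

text \<open>On a cube around v + y that is smaller than every nonzero coordinate of y, the
  displacement from v keeps the sign of y on the support of y. Only the remaining coordinates are
  free, and there the signs of t decide.\<close>

lemma local_form_nearby:
  assumes "local_form P v S r" "\<And>i. \<bar>y $ i\<bar> < r"
  shows "\<exists>q. local_form P (v + y) {t. is_sign t \<and> override_signs y t \<in> S} q"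
proof -
  \<comment> \<open>The first bound keeps the new cube inside the old one, the second keeps the sign
    of the nonzero coordinates of y; 1 is again a dummy.\<close>
  define f where "f i = min (r - \<bar>y $ i\<bar>) (if y $ i = 0 then 1 else \<bar>y $ i\<bar>)" for i
  have "0 < f i" for i using assms(2)[of i] by (simp add: f_def)
  then obtain q where q: "0 < q" "\<And>i. q < f i" using uniform_lower_bound by metis
  have qr: "q < r - \<bar>y $ i\<bar>" for i using q(2)[of i] by (simp add: f_def)
  have qy: "q < \<bar>y $ i\<bar>" if "y $ i \<noteq> 0" for i using q(2)[of i] that by (simp add: f_def)
  let ?T = "{t. is_sign t \<and> override_signs y t \<in> S}"
  have "v + y + x \<in> P \<longleftrightarrow> x \<in> arrangement ?T" if x: "\<forall>i. \<bar>x $ i\<bar> \<le> q" for x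
  proof -
    have sign_yx: "sgn (y $ i + x $ i) = sgn (y $ i)" if "y $ i \<noteq> 0" for i
      using qy[OF that] x[rule_format, of i] that unfolding sgn_if by argo
    have nz: "y $ i + x $ i \<noteq> 0" if "y $ i \<noteq> 0" for i
      using sign_yx[OF that] that by (metis sgn_zero_iff)
    have "\<bar>(y + x) $ i\<bar> \<le> r" for i
      using qr[of i] x[rule_format, of i] by simp
    then have "v + y + x \<in> P \<longleftrightarrow> (\<exists>s\<in>S. \<forall>i. 0 \<le> s i * (y $ i + x $ i))"
      using assms(1) by (simp add: local_form_def arrangement_def orthant_def add.assoc)
    also have "\<dots> \<longleftrightarrow> (\<exists>t\<in>?T. \<forall>i. 0 \<le> t i * x $ i)"
    proof
      assume "\<exists>s\<in>S. \<forall>i. 0 \<le> s i * (y $ i + x $ i)"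
      then obtain s where s: "s \<in> S" "\<And>i. 0 \<le> s i * (y $ i + x $ i)" by blast
      have sg: "is_sign s" using s(1) assms(1) by (auto simp: local_form_def)
      \<comment> \<open>On the support of y the override discards t, so there t may simply follow
        the sign of x.\<close>
      define t where "t = (\<lambda>i. if y $ i = 0 then s i else if x $ i \<ge> 0 then 1 else -1)"
      have "s i = sgn (y $ i)" if "y $ i \<noteq> 0" for i
        using s(2)[of i] sign_yx[OF that] nz[OF that] is_sign_cases[OF sg, of i]
        by (auto simp: sgn_if split: if_splits)
      then have "override_signs y t = s" by (auto simp: override_signs_def t_def)
      moreover have "is_sign t" using sg by (auto simp: t_def is_sign_def)
      moreover have "0 \<le> t i * x $ i" for i
        using s(2)[of i] by (auto simp: t_def)
      ultimately show "\<exists>t\<in>?T. \<forall>i. 0 \<le> t i * x $ i" using s(1) by blast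
    next
      assume "\<exists>t\<in>?T. \<forall>i. 0 \<le> t i * x $ i"
      then obtain t where t: "override_signs y t \<in> S" "\<And>i. 0 \<le> t i * x $ i" by blast
      have "0 \<le> override_signs y t i * (y $ i + x $ i)" for i
      proof (cases "y $ i = 0")
        case True
        then show ?thesis using t(2)[of i] by (simp add: override_signs_def)
      next
        case False
        then show ?thesis using sign_yx[OF False]
          by (simp add: override_signs_def) (metis abs_ge_zero abs_sgn mult.commute)
      qed
      then show "\<exists>s\<in>S. \<forall>i. 0 \<le> s i * (y $ i + x $ i)" using t(1) by blast
    qed
    also have "\<dots> \<longleftrightarrow> x \<in> arrangement ?T" by (simp add: arrangement_def orthant_def)
    finally show ?thesis .
  qed
  then have "local_form P (v + y) ?T q" using q(1) by (auto simp: local_form_def)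
  then show ?thesis by blast
qed

lemma germ_nearby:
  assumes "orthogonal_polytope P"
  shows "\<exists>r>0. \<forall>y. (\<forall>i. \<bar>y $ i\<bar> < r) \<longrightarrow>
    germ P (v + y) = {t. is_sign t \<and> override_signs y t \<in> germ P v}"
proof -
  obtain S r where S: "local_form P v S r"
    using orthogonal_polytope_local_form[OF assms] by blast
  have "germ P (v + y) = {t. is_sign t \<and> override_signs y t \<in> S}" if "\<forall>i. \<bar>y $ i\<bar> < r" for y
    using local_form_nearby[OF S] that germ_local_form by blast
  moreover have "0 < r" using S by (simp add: local_form_def)
  ultimately show ?thesis unfolding germ_local_form[OF S] by blast
qed

section \<open>Inessential coordinates\<close>

definition inessential :: "('n \<Rightarrow> real) set \<Rightarrow> 'n set" where
  "inessential S = {i. \<forall>t. is_sign t \<longrightarrow> (t(i := - t i) \<in> S \<longleftrightarrow> t \<in> S)}"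

lemma inessential_upd:
  assumes "i \<in> inessential S" "is_sign t" "e = 1 \<or> e = -1"
  shows "t(i := e) \<in> S \<longleftrightarrow> t \<in> S"
proof -
  have "t(i := - t i) \<in> S \<longleftrightarrow> t \<in> S" using assms by (auto simp: inessential_def)
  moreover have "e = t i \<or> e = - t i" using assms(3) is_sign_cases[OF assms(2), of i] by auto
  ultimately show ?thesis by auto
qed

lemma inessential_agree:
  fixes t t' :: "'n::finite \<Rightarrow> real"
  assumes "is_sign t" "is_sign t'" "{i. t i \<noteq> t' i} \<subseteq> inessential S"
  shows "t \<in> S \<longleftrightarrow> t' \<in> S"
proof -
  \<comment> \<open>Differing coordinates are corrected one at a time. The induction runs over a
    superset K of the difference set, because a coordinate in K may already agree.\<close>
  have "t \<in> S \<longleftrightarrow> t' \<in> S"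
    if "finite K" "is_sign t" "{i. t i \<noteq> t' i} \<subseteq> K" "K \<subseteq> inessential S" for K t
    using that
  proof (induction K arbitrary: t rule: finite_induct)
    case empty
    then have "t = t'" by auto
    then show ?case by simp
  next
    case (insert k K)
    have k: "t' k = 1 \<or> t' k = -1" by (rule is_sign_cases[OF assms(2)])
    have "k \<in> inessential S" using insert.prems(3) by simp
    then have "t(k := t' k) \<in> S \<longleftrightarrow> t \<in> S"
      using insert.prems(1) k by (rule inessential_upd)
    moreover have "t(k := t' k) \<in> S \<longleftrightarrow> t' \<in> S"
    proof (rule insert.IH)
      show "is_sign (t(k := t' k))" using insert.prems(1) k by (rule is_sign_upd)
    qed (use insert.prems in auto)
    ultimately show ?case by simp
  qed
  from this[OF finite assms(1) subset_refl assms(3)] show ?thesis .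
qed

section \<open>Congruence invariance and monotonicity of inessential coordinates\<close>

lemma congruent_cones_refl: "congruent_cones A A"
proof -
  have "A = (\<lambda>x. \<chi> i. 1 * x $ id i) ` A" by simp
  then show ?thesis
    unfolding congruent_cones_def
    by (intro exI[of _ id] exI[of _ "\<lambda>_. 1"] conjI) (simp_all add: is_sign_def)
qed

text \<open>A signed permutation maps orthants to orthants and turns a flip of one coordinate into a
  flip of another, so p carries the inessential coordinates of \<open>S'\<close> onto those of S.
  This is the only congruence invariant that the proof uses.\<close>

lemma congruent_cones_card_inessential:
  assumes "congruent_cones (arrangement S) (arrangement S')"
    and "S \<subseteq> {s. is_sign s}" "S' \<subseteq> {s. is_sign s}"
  shows "card (inessential S) = card (inessential S')"
proof -
  obtain p s where p: "bij p" and s: "is_sign s"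
    and eq: "arrangement S' = (\<lambda>x. \<chi> i. s i * x $ p i) ` arrangement S"
    using assms(1) by (auto simp: congruent_cones_def)
  have ss: "s i * s i = 1" for i using is_sign_cases[OF s, of i] by auto
  \<comment> \<open>\<open>T'\<close> is the signed permutation acting on sign vectors and T its
    inverse. As \<open>arrangement S'\<close> is the image under the forward map, membership in
    \<open>S'\<close> is tested by applying T.\<close>
  define T where "T t = (\<lambda>j. s (inv p j) * t (inv p j))" for t :: "'a \<Rightarrow> real"
  define T' where "T' t = (\<lambda>i. s i * t (p i))" for t :: "'a \<Rightarrow> real"
  have pi: "p (inv p j) = j" "inv p (p j) = j" for j
    using p by (simp_all add: bij_is_surj bij_is_inj surj_f_inv_f)
  have TT: "T (T' t) = t" "T' (T t) = t" for t
    unfolding T_def T'_def using ss by (auto simp: pi fun_eq_iff mult.assoc[symmetric])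
  have mult_sign: "s i * x = 1 \<or> s i * x = -1" if "x = 1 \<or> x = -1" for i x
    using is_sign_cases[OF s, of i] that by auto
  have sT: "is_sign (T t)" "is_sign (T' t)" if "is_sign t" for t
    using mult_sign is_sign_cases[OF that] unfolding T_def T'_def is_sign_def by auto
  have mem: "t \<in> S' \<longleftrightarrow> T t \<in> S" if "is_sign t" for t
  proof -
    have "t \<in> S' \<longleftrightarrow> sign_vec t \<in> arrangement S'"
      using sign_vec_in_arrangement[OF assms(3) that] by simp
    also have "\<dots> \<longleftrightarrow> (\<exists>x\<in>arrangement S. \<forall>i. t i = s i * x $ p i)"
      by (auto simp: eq image_iff vec_eq_iff)
    also have "\<dots> \<longleftrightarrow> (\<exists>x\<in>arrangement S. x = sign_vec (T t))"
    proof -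
      have "(\<forall>i. t i = s i * x $ p i) \<longleftrightarrow> x = sign_vec (T t)" for x
      proof
        assume h: "\<forall>i. t i = s i * x $ p i"
        have "x $ j = T t j" for j
          using h[rule_format, of "inv p j"] ss[of "inv p j"]
          by (simp add: T_def pi mult.assoc[symmetric])
        then show "x = sign_vec (T t)" by (simp add: vec_eq_iff)
      next
        assume "x = sign_vec (T t)"
        then show "\<forall>i. t i = s i * x $ p i" by (simp add: T_def pi ss mult.assoc[symmetric])
      qed
      then show ?thesis by simp
    qed
    also have "\<dots> \<longleftrightarrow> T t \<in> S" using sign_vec_in_arrangement[OF assms(2) sT(1)[OF that]] by simp
    finally show ?thesis .
  qed
  have Tupd: "T (t(i := - t i)) = (T t)(p i := - T t (p i))" for t i
    using pi by (auto simp: T_def fun_eq_iff)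
  have neg: "is_sign (t(i := - t i))" if "is_sign t" for t :: "'a \<Rightarrow> real" and i
    using that by (auto simp: is_sign_def)
  have iff: "i \<in> inessential S' \<longleftrightarrow> p i \<in> inessential S" for i
  proof
    assume i: "i \<in> inessential S'"
    have "t(p i := - t (p i)) \<in> S \<longleftrightarrow> t \<in> S" if t: "is_sign t" for t
    proof -
      have "(T' t)(i := - T' t i) \<in> S' \<longleftrightarrow> T' t \<in> S'"
        using i sT(2)[OF t] by (auto simp: inessential_def)
      then show ?thesis
        using mem[OF sT(2)[OF t]] mem[OF neg[OF sT(2)[OF t]]] by (simp add: Tupd TT)
    qed
    then show "p i \<in> inessential S" by (simp add: inessential_def)
  next
    assume i: "p i \<in> inessential S"
    have "t(i := - t i) \<in> S' \<longleftrightarrow> t \<in> S'" if t: "is_sign t" for t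
      using i sT(1)[OF t] mem[OF t] mem[OF neg[OF t]] by (auto simp: Tupd inessential_def)
    then show "i \<in> inessential S'" by (simp add: inessential_def)
  qed
  have "inessential S = p ` inessential S'"
  proof
    show "inessential S \<subseteq> p ` inessential S'"
      using iff pi by (metis image_eqI subsetI)
  qed (use iff in auto)
  then show ?thesis using p by (metis bij_is_inj card_image inj_on_subset subset_UNIV)
qed

text \<open>Flips on the support of y are overwritten, and flips elsewhere commute with the
  override. Hence a small move never loses an inessential coordinate.\<close>

lemma inessential_override:
  "inessential S \<union> {i. y $ i \<noteq> 0} \<subseteq> inessential {t. is_sign t \<and> override_signs y t \<in> S}"
proof
  fix i assume i: "i \<in> inessential S \<union> {i. y $ i \<noteq> 0}"
  have "override_signs y (t(i := - t i)) \<in> S \<longleftrightarrow> override_signs y t \<in> S" if t: "is_sign t" for t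
  proof (cases "y $ i = 0")
    case True
    then have "override_signs y (t(i := - t i)) = (override_signs y t)(i := - override_signs y t i)"
      by (auto simp: override_signs_def)
    then show ?thesis using i True is_sign_override[OF t] by (auto simp: inessential_def)
  next
    case False
    then have "override_signs y (t(i := - t i)) = override_signs y t"
      by (auto simp: override_signs_def)
    then show ?thesis by simp
  qed
  moreover have "is_sign (t(i := - t i))" if "is_sign t" for t :: "'a \<Rightarrow> real"
    using that by (auto simp: is_sign_def)
  ultimately show "i \<in> inessential {t. is_sign t \<and> override_signs y t \<in> S}"
    by (simp add: inessential_def)
qed

lemma override_inessential:
  fixes S :: "('n::finite \<Rightarrow> real) set"
  assumes "{i. y $ i \<noteq> 0} \<subseteq> inessential S" "S \<subseteq> {s. is_sign s}"
  shows "{t. is_sign t \<and> override_signs y t \<in> S} = S"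
proof -
  have "override_signs y t \<in> S \<longleftrightarrow> t \<in> S" if "is_sign t" for t
    using that assms(1) is_sign_override[OF that]
    by (intro inessential_agree) (auto simp: override_signs_def)
  then show ?thesis using assms(2) by auto
qed

text \<open>The link in direction e along axis i. Coordinate i is left free instead of being
  deleted, so that the result is again a germ in the same space, namely that of the nearby points on
  the ray.\<close>

definition restrict_sign :: "'n \<Rightarrow> real \<Rightarrow> ('n \<Rightarrow> real) set \<Rightarrow> ('n \<Rightarrow> real) set" where
  "restrict_sign i e S = {t. is_sign t \<and> t(i := e) \<in> S}"

lemma germ_on_ray:
  assumes "orthogonal_polytope P"
  shows "\<exists>r>0. \<forall>i e c. (e = 1 \<or> e = -1) \<longrightarrow> 0 < c \<longrightarrow> c < r \<longrightarrow>
    germ P (v + axis i (e * c)) = restrict_sign i e (germ P v)"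
proof -
  obtain r where r: "0 < r" "\<And>y. \<forall>i. \<bar>y $ i\<bar> < r \<Longrightarrow>
      germ P (v + y) = {t. is_sign t \<and> override_signs y t \<in> germ P v}"
    using germ_nearby[OF assms] by blast
  have "germ P (v + axis i (e * c)) = restrict_sign i e (germ P v)"
    if "e = 1 \<or> e = -1" "0 < c" "c < r" for i e c
  proof -
    have "\<forall>j. \<bar>axis i (e * c) $ j\<bar> < r" using that r(1) by (auto simp: axis_def)
    moreover have "override_signs (axis i (e * c)) t = t(i := e)" for t
      using that by (auto simp: override_signs_def axis_def)
    ultimately show ?thesis using r(2) by (simp add: restrict_sign_def)
  qed
  then show ?thesis using r(1) by blast
qed

lemma restrict_sign_inessential:
  fixes S :: "('n::finite \<Rightarrow> real) set"
  assumes "i \<in> inessential S" "S \<subseteq> {s. is_sign s}" "e = 1 \<or> e = -1"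
  shows "restrict_sign i e S = S"
  using assms inessential_upd[of i S _ e] by (auto simp: restrict_sign_def)

lemma inessential_restrict_sign:
  fixes S :: "('n::finite \<Rightarrow> real) set"
  assumes "e = 1 \<or> e = -1"
  shows "inessential S \<union> {i} \<subseteq> inessential (restrict_sign i e S)"
proof -
  have "override_signs (axis i e) t = t(i := e)" for t
    using assms by (auto simp: override_signs_def axis_def)
  moreover have "{j. (axis i e :: real^'n) $ j \<noteq> 0} = {i}" using assms by (auto simp: axis_def)
  ultimately show ?thesis
    using inessential_override[of S "axis i e"] by (simp add: restrict_sign_def)
qed

section \<open>Genericity regions\<close>

text \<open>Near a point the set of inessential coordinates can only grow, and equal cardinality
  stops it from growing. The displacement is then supported on inessential coordinates, so it
  changes neither the germ nor an essential coordinate. Connectedness makes this local relation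
  global.\<close>

lemma germ_locally_constant:
  assumes "orthogonal_polytope P" and "connected C"
    and card: "\<And>u. u \<in> C \<Longrightarrow> card (inessential (germ P u)) = k"
    and "a \<in> C" "b \<in> C"
  shows "germ P a = germ P b \<and> (\<forall>i. i \<notin> inessential (germ P a) \<longrightarrow> a $ i = b $ i)"
proof (rule connected_equivalence_relation[OF assms(2,4,5)])
  fix a assume a: "a \<in> C"
  obtain r where r: "0 < r" "\<And>y. \<forall>i. \<bar>y $ i\<bar> < r \<Longrightarrow>
      germ P (a + y) = {t. is_sign t \<and> override_signs y t \<in> germ P a}"
    using germ_nearby[OF assms(1)] by blast
  have "germ P a = germ P x \<and> (\<forall>i. i \<notin> inessential (germ P a) \<longrightarrow> a $ i = x $ i)"
    if "x \<in> C \<inter> ball a r" for x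
  proof -
    have "\<bar>(x - a) $ i\<bar> < r" for i
      using that component_le_norm_cart[of "x - a" i] by (auto simp: dist_norm norm_minus_commute)
    then have x: "germ P x = {t. is_sign t \<and> override_signs (x - a) t \<in> germ P a}"
      using r(2)[of "x - a"] by simp
    have "inessential (germ P a) \<union> {i. (x - a) $ i \<noteq> 0} \<subseteq> inessential (germ P x)"
      unfolding x by (rule inessential_override)
    moreover have "inessential (germ P a) = inessential (germ P x)"
      using calculation card[OF a] card[of x] that
      by (intro card_subset_eq) auto
    ultimately have supp: "{i. (x - a) $ i \<noteq> 0} \<subseteq> inessential (germ P a)" by blast
    then have "germ P x = germ P a"
      unfolding x using germ_is_sign by (intro override_inessential) auto
    moreover have "a $ i = x $ i" if "i \<notin> inessential (germ P a)" for i
    proof -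
      have "i \<notin> {i. (x - a) $ i \<noteq> 0}" using supp that by blast
      then show ?thesis by simp
    qed
    ultimately show ?thesis by simp
  qed
  then show "\<exists>T. openin (top_of_set C) T \<and> a \<in> T \<and> (\<forall>x\<in>T. germ P a = germ P x \<and>
      (\<forall>i. i \<notin> inessential (germ P a) \<longrightarrow> a $ i = x $ i))"
    using a r(1) by (intro exI[of _ "C \<inter> ball a r"]) (auto simp: openin_open_Int)
qed auto

text \<open>Congruent cones have equally many inessential coordinates, so along a path they force
  one germ. Conversely equal germs give equal cones, and a nonempty germ keeps the path inside
  P.\<close>

lemma genericity_region_eq:
  assumes "orthogonal_polytope P" "v \<in> P"
  shows "genericity_region P v = path_component_set {u. germ P u = germ P v} v"
proof -
  have "germ P u = germ P v"
    if g: "path g" "pathstart g = v" "u \<in> path_image g"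
      "\<forall>u\<in>path_image g. congruent_cones (tangent_cone P u) (tangent_cone P v)" for g u
  proof -
    have "card (inessential (germ P w)) = card (inessential (germ P v))" if "w \<in> path_image g" for w
      using g(4) that germ_is_sign
      by (intro congruent_cones_card_inessential) (auto simp: tangent_cone_germ[OF assms(1), symmetric])
    moreover have "v \<in> path_image g" using g(2) pathstart_in_path_image by blast
    ultimately show ?thesis
      using germ_locally_constant[OF assms(1) connected_path_image[OF g(1)]] g(3) by blast
  qed
  moreover have "u \<in> P \<and> congruent_cones (tangent_cone P u) (tangent_cone P v)"
    if "germ P u = germ P v" for u
    using that assms germ_empty_iff[OF assms(1)] congruent_cones_refl tangent_cone_germ by metis
  ultimately have "path g \<and> path_image g \<subseteq> P \<and> pathstart g = v \<and> pathfinish g = w \<and>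
      (\<forall>u\<in>path_image g. congruent_cones (tangent_cone P u) (tangent_cone P v)) \<longleftrightarrow>
    path g \<and> path_image g \<subseteq> {u. germ P u = germ P v} \<and> pathstart g = v \<and> pathfinish g = w"
    for g w
    by blast
  moreover have "w \<in> P" if "path_image g \<subseteq> P" "pathfinish g = w" for g w
    using that pathfinish_in_path_image by blast
  ultimately show ?thesis
    unfolding genericity_region_def path_component_def by blast
qed

lemma genericity_region_flat:
  assumes "orthogonal_polytope P" "v \<in> P" "w \<in> genericity_region P v"
  shows "germ P w = germ P v" "i \<notin> inessential (germ P v) \<Longrightarrow> w $ i = v $ i"
proof -
  let ?C = "path_component_set {u. germ P u = germ P v} v"
  have sub: "?C \<subseteq> {u. germ P u = germ P v}" by (rule path_component_subset)
  have w: "w \<in> ?C" using assms genericity_region_eq by blast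
  then show "germ P w = germ P v" using sub by blast
  have "v \<in> ?C" by (simp add: path_component_refl)
  moreover have "connected ?C" by (simp add: path_connected_imp_connected)
  moreover have "card (inessential (germ P u)) = card (inessential (germ P v))" if "u \<in> ?C" for u
    using sub that by auto
  ultimately show "w $ i = v $ i" if "i \<notin> inessential (germ P v)"
    using germ_locally_constant[OF assms(1) _ _ _ w] that by metis
qed

section \<open>Degrees of genericity regions, and vertices\<close>

lemma segment_path_component:
  fixes v w :: "'a::real_normed_vector"
  shows "closed_segment v w \<subseteq> S \<Longrightarrow> path_component S v w"
  unfolding path_component_def by (rule exI[of _ "linepath v w"]) simp

lemma segment_along_axis:
  fixes v :: "real^'n"
  assumes "u \<in> closed_segment v (v + axis i c)"
  obtains x where "0 \<le> x" "x \<le> 1" "u = v + axis i (x * c)"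
proof -
  from assms obtain x where x: "0 \<le> x" "x \<le> 1" "u = (1 - x) *\<^sub>R v + x *\<^sub>R (v + axis i c)"
    by (auto simp: in_segment)
  have "u = v + axis i (x * c)"
    unfolding x(3) by (simp add: vec_eq_iff axis_def algebra_simps)
  with x show thesis by (intro that)
qed

lemma coord_flat_aff_dim:
  fixes c :: "'n::finite \<Rightarrow> real"
  shows "aff_dim (coord_flat I c) = int (card (- I))"
proof -
  have sub: "subspace {x :: real^'n. \<forall>i. i \<notin> - I \<longrightarrow> x $ i = 0}"
    by (auto simp: subspace_def)
  have "x \<in> coord_flat I c \<longleftrightarrow> x - (\<chi> i. c i) \<in> {x. \<forall>i. i \<notin> - I \<longrightarrow> x $ i = 0}" for x
    by (simp add: coord_flat_def Ball_def)
  moreover have "x \<in> (+) z ` L \<longleftrightarrow> x - z \<in> L" for x z and L :: "(real^'n) set"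
    by (auto simp: image_iff) (metis add.commute diff_add_cancel)
  ultimately have eq: "coord_flat I c = (+) (\<chi> i. c i) ` {x. \<forall>i. i \<notin> - I \<longrightarrow> x $ i = 0}"
    by (simp only: set_eq_iff simp_thms)
  have "vec.dim {x :: real^'n. \<forall>i. i \<notin> - I \<longrightarrow> x $ i = 0} = card (- I)"
    by (rule dim_substandard_cart)
  then show ?thesis
    unfolding eq aff_dim_translation_eq aff_dim_subspace[OF sub] dim_vec_eq by (rule arg_cong)
qed

text \<open>The region lies in the flat that fixes all essential coordinates at their values in v.
  No smaller flat works, since the region contains a second point displaced from v along each
  inessential axis.\<close>

lemma region_degree_eq:
  assumes "orthogonal_polytope P" "v \<in> P"
  shows "region_degree (genericity_region P v) = card (inessential (germ P v))"
proof -
  let ?J = "inessential (germ P v)"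
  obtain r where r: "0 < r" "\<And>i e c. e = 1 \<or> e = -1 \<Longrightarrow> 0 < c \<Longrightarrow> c < r \<Longrightarrow>
      germ P (v + axis i (e * c)) = restrict_sign i e (germ P v)"
    using germ_on_ray[OF assms(1)] by metis
  have near: "v + axis i (r/2) \<in> genericity_region P v" if "i \<in> ?J" for i
  proof -
    have "germ P (v + axis i c) = germ P v" if "0 \<le> c" "c < r" for c
    proof (cases "c = 0")
      case False
      then have "germ P (v + axis i c) = restrict_sign i 1 (germ P v)"
        using r(2)[of 1 c i] that by simp
      also have "\<dots> = germ P v"
        using \<open>i \<in> ?J\<close> germ_is_sign by (intro restrict_sign_inessential) auto
      finally show ?thesis .
    qed (simp add: axis_eq_0_iff[THEN iffD2])
    note const = this
    have "closed_segment v (v + axis i (r/2)) \<subseteq> {u. germ P u = germ P v}"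
    proof
      fix u assume "u \<in> closed_segment v (v + axis i (r/2))"
      then obtain x where x: "0 \<le> x" "x \<le> 1" "u = v + axis i (x * (r/2))"
        by (rule segment_along_axis)
      have "x * (r/2) \<le> 1 * (r/2)" using x r(1) by (intro mult_right_mono) auto
      then show "u \<in> {u. germ P u = germ P v}" using const x r(1) by simp
    qed
    then show ?thesis
      unfolding genericity_region_eq[OF assms] using segment_path_component by blast
  qed
  show ?thesis unfolding region_degree_def
  proof (rule Least_equality)
    have "genericity_region P v \<subseteq> coord_flat (- ?J) (\<lambda>i. v $ i)"
      using genericity_region_flat[OF assms] by (auto simp: coord_flat_def)
    then show "\<exists>I c. genericity_region P v \<subseteq> coord_flat I c \<and>
        aff_dim (coord_flat I c) = int (card ?J)"
      using coord_flat_aff_dim[of "- ?J" "\<lambda>i. v $ i"] by auto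
  next
    fix k assume "\<exists>I c. genericity_region P v \<subseteq> coord_flat I c \<and>
        aff_dim (coord_flat I c :: (real^'a) set) = int k"
    then obtain I c where I: "genericity_region P v \<subseteq> coord_flat I c" "k = card (- I)"
      unfolding coord_flat_aff_dim by auto
    have v: "v \<in> genericity_region P v"
      unfolding genericity_region_eq[OF assms] by (simp add: path_component_refl)
    have "i \<notin> I" if "i \<in> ?J" for i
    proof
      assume "i \<in> I"
      then have "(v + axis i (r/2)) $ i = c i" "v $ i = c i"
        using v near[OF that] I(1) unfolding coord_flat_def by blast+
      then show False using r(1) by simp
    qed
    then have "?J \<subseteq> - I" by blast
    then show "card ?J \<le> k" using I(2) by (simp add: card_mono)
  qed
qed

lemma vertices_eq:
  fixes P :: "(real^'n) set"
  assumes "orthogonal_polytope P"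
  shows "v \<in> vertices P \<longleftrightarrow> v \<in> P \<and> inessential (germ P v) = {}"
proof -
  have "card (inessential (germ P v)) = 0 \<longleftrightarrow> inessential (germ P v) = {}"
    by (rule card_0_eq) simp
  then show ?thesis using region_degree_eq[OF assms] by (auto simp: vertices_def)
qed

section \<open>Alternating counts of local arrangements\<close>

text \<open>The unnormalised Walsh-Fourier coefficient of the indicator of S at the full set of
  coordinates.\<close>

definition signed_count :: "('n::finite \<Rightarrow> real) set \<Rightarrow> real" where
  "signed_count S = (\<Sum>t\<in>S. \<Prod>i\<in>UNIV. t i)"

text \<open>It is applied to links R, in which i is inessential. There the slice
  \<open>t i = 1\<close> is a mere choice of representatives, made the same way for links seen from
  either side.\<close>

definition link_count :: "'n::finite \<Rightarrow> ('n \<Rightarrow> real) set \<Rightarrow> real" where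
  "link_count i R = (\<Sum>t\<in>{t\<in>R. t i = 1}. \<Prod>j\<in>UNIV - {i}. t j)"

lemma link_count_empty: "link_count i {} = 0"
  by (simp add: link_count_def)

text \<open>Split S by the sign of coordinate i and pull the factor \<open>t i\<close> out of the
  product; it is 1 on one half and -1 on the other.\<close>

lemma signed_count_link_count:
  fixes S :: "('n::finite \<Rightarrow> real) set"
  assumes S: "S \<subseteq> {s. is_sign s}"
  shows "signed_count S = link_count i (restrict_sign i 1 S) - link_count i (restrict_sign i (-1) S)"
proof -
  let ?A = "{t\<in>S. t i = 1}" and ?B = "{t\<in>S. t i = -1}"
  have fin: "finite S" using finite_subset[OF S finite_signs] .
  have split: "(\<Prod>j\<in>UNIV. t j) = t i * (\<Prod>j\<in>UNIV - {i}. t j)" for t :: "'n \<Rightarrow> real"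
    by (simp add: prod.remove)
  have "t i = 1 \<or> t i = -1" if "t \<in> S" for t
    using S that by (intro is_sign_cases) auto
  then have "S = ?A \<union> ?B" by blast
  then have "signed_count S = (\<Sum>t\<in>?A \<union> ?B. \<Prod>j\<in>UNIV. t j)" by (simp add: signed_count_def)
  also have "\<dots> = (\<Sum>t\<in>?A. \<Prod>j\<in>UNIV. t j) + (\<Sum>t\<in>?B. \<Prod>j\<in>UNIV. t j)"
    using fin by (intro sum.union_disjoint) auto
  also have "(\<Sum>t\<in>?A. \<Prod>j\<in>UNIV. t j) = link_count i (restrict_sign i 1 S)"
    unfolding link_count_def split
  proof (rule sum.cong)
    show "?A = {t \<in> restrict_sign i 1 S. t i = 1}"
      using S by (auto simp: restrict_sign_def fun_upd_idem)
  qed simp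
  \<comment> \<open>The negative half must be moved to the slice \<open>t i = 1\<close> used by
    \<open>link_count\<close>; this leaves the product over the other coordinates unchanged.\<close>
  also have "(\<Sum>t\<in>?B. \<Prod>j\<in>UNIV. t j) = - link_count i (restrict_sign i (-1) S)"
    unfolding link_count_def split sum_negf[symmetric]
  proof (rule sum.reindex_bij_witness[of _ "\<lambda>t. t(i := -1)" "\<lambda>t. t(i := 1)"])
    fix t assume "t \<in> ?B"
    then show "t(i := 1) \<in> {t \<in> restrict_sign i (-1) S. t i = 1}"
      using S is_sign_upd[of t 1 i] by (auto simp: restrict_sign_def fun_upd_idem)
    show "- (\<Prod>j\<in>UNIV - {i}. (t(i := 1)) j) = t i * (\<Prod>j\<in>UNIV - {i}. t j)"
      using \<open>t \<in> ?B\<close> by simp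
  qed (auto simp: restrict_sign_def fun_upd_idem)
  finally show ?thesis by simp
qed

text \<open>Flipping j is a sign-reversing involution of the slice, so the sum equals its own
  negative.\<close>

lemma link_count_inessential:
  fixes R :: "('n::finite \<Rightarrow> real) set"
  assumes R: "R \<subseteq> {s. is_sign s}" and j: "j \<in> inessential R" "j \<noteq> i"
  shows "link_count i R = 0"
proof -
  have flip: "t(j := - t j) \<in> R" if "t \<in> R" for t
    using j(1) R that by (auto simp: inessential_def)
  have "link_count i R = (\<Sum>t\<in>{t\<in>R. t i = 1}. - (\<Prod>k\<in>UNIV - {i}. t k))"
    unfolding link_count_def
  proof (rule sum.reindex_bij_witness[of _ "\<lambda>t. t(j := - t j)" "\<lambda>t. t(j := - t j)"])
    fix t assume t: "t \<in> {t\<in>R. t i = 1}"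
    show "t(j := - t j) \<in> {t\<in>R. t i = 1}" using t j(2) flip by auto
    have "(\<Prod>k\<in>UNIV - {i}. u k) = u j * (\<Prod>k\<in>UNIV - {i} - {j}. u k)" for u :: "'n \<Rightarrow> real"
      using j(2) by (intro prod.remove) auto
    then show "- (\<Prod>k\<in>UNIV - {i}. (t(j := - t j)) k) = (\<Prod>k\<in>UNIV - {i}. t k)"
      by simp
  qed (use flip j(2) in auto)
  then show ?thesis by (simp add: link_count_def sum_negf)
qed

section \<open>Alternating sums over subsets, and read-once formulas\<close>

definition alt_sum :: "'e set \<Rightarrow> 'e set set \<Rightarrow> int" where
  "alt_sum E A = (\<Sum>X\<in>Pow E. if X \<in> A then (-1) ^ card X else 0)"

text \<open>Subsets of a disjoint union are pairs of subsets, and the sign is multiplicative in the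
  pair. The two hypotheses on A and B say that each family sees only its own part.\<close>

lemma alt_sum_mult:
  assumes "finite E" "finite F" "E \<inter> F = {}"
    and A: "\<And>X. X \<in> A \<longleftrightarrow> X \<inter> E \<in> A" and B: "\<And>X. X \<in> B \<longleftrightarrow> X \<inter> F \<in> B"
  shows "alt_sum (E \<union> F) (A \<inter> B) = alt_sum E A * alt_sum F B"
proof -
  have "alt_sum E A * alt_sum F B = (\<Sum>(X, Y)\<in>Pow E \<times> Pow F.
      (if X \<in> A then (-1) ^ card X else 0) * (if Y \<in> B then (-1) ^ card Y else 0))"
    unfolding alt_sum_def sum_product sum.cartesian_product ..
  also have "\<dots> = alt_sum (E \<union> F) (A \<inter> B)"
    unfolding alt_sum_def
  proof (rule sum.reindex_bij_witness[of _ "\<lambda>Z. (Z \<inter> E, Z \<inter> F)" "\<lambda>(X, Y). X \<union> Y"])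
    fix a assume "a \<in> Pow E \<times> Pow F"
    then obtain X Y where a: "a = (X, Y)" "X \<subseteq> E" "Y \<subseteq> F" by auto
    have eq: "(X \<union> Y) \<inter> E = X" "(X \<union> Y) \<inter> F = Y" using a assms(3) by auto
    have "card (X \<union> Y) = card X + card Y"
      using a assms by (intro card_Un_disjoint) (auto intro: finite_subset)
    then show "(if (case a of (X, Y) \<Rightarrow> X \<union> Y) \<in> A \<inter> B
         then (- 1) ^ card (case a of (X, Y) \<Rightarrow> X \<union> Y) else (0 :: int)) =
       (case a of (X, Y) \<Rightarrow>
          (if X \<in> A then (- 1) ^ card X else 0) * (if Y \<in> B then (- 1) ^ card Y else 0))"
      using A[of "X \<union> Y"] B[of "X \<union> Y"] eq by (simp add: a power_add)
    show "(\<lambda>Z. (Z \<inter> E, Z \<inter> F)) (case a of (X, Y) \<Rightarrow> X \<union> Y) = a"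
      using eq by (simp add: a)
  qed auto
  finally show ?thesis by simp
qed

text \<open>Splitting off one element leaves the factor 1 - 1.\<close>

lemma alt_sum_UNIV:
  assumes "finite E" "E \<noteq> {}"
  shows "alt_sum E UNIV = 0"
proof -
  obtain e where e: "e \<in> E" using assms(2) by blast
  have "alt_sum ({e} \<union> (E - {e})) (UNIV \<inter> UNIV) = alt_sum {e} UNIV * alt_sum (E - {e}) UNIV"
    using assms(1) by (intro alt_sum_mult) auto
  moreover have "alt_sum {e} UNIV = 0" by (simp add: alt_sum_def Pow_insert)
  ultimately show ?thesis using e by (simp add: insert_absorb)
qed

lemma alt_sum_Un: "alt_sum E (A \<union> B) = alt_sum E A + alt_sum E B - alt_sum E (A \<inter> B)"
  unfolding alt_sum_def sum.distrib[symmetric] sum_subtractf[symmetric]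
  by (rule sum.cong) auto

text \<open>X holds the edges whose literal fails. With this coding X is exactly the set where a
  sign vector differs from s, as \<open>sign_vec_in_floral\<close> uses.\<close>

definition false_sets :: "'e spd \<Rightarrow> 'e set set" where
  "false_sets D = spd_interp (\<lambda>e. {X. e \<notin> X}) D"

lemma spd_edges_finite: "finite (spd_edges D)" and spd_edges_nonempty: "spd_edges D \<noteq> {}"
  by (induction D) auto

lemma false_sets_local: "X \<in> false_sets D \<longleftrightarrow> X \<inter> spd_edges D \<in> false_sets D"
proof -
  have "X \<inter> spd_edges D = Y \<inter> spd_edges D \<Longrightarrow> X \<in> false_sets D \<longleftrightarrow> Y \<in> false_sets D" for X Y
    by (induction D) (auto simp: false_sets_def)
  then show ?thesis by (metis inf.right_idem)
qed

text \<open>Series connection is the product rule. For parallel connection, inclusion-exclusion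
  leaves only minus the product, because a family that constrains one part alone picks up the zero
  sum of the other, nonempty part.\<close>

lemma alt_sum_false_sets:
  assumes "is_spd D"
  shows "alt_sum (spd_edges D) (false_sets D) = 1 \<or> alt_sum (spd_edges D) (false_sets D) = -1"
  using assms
proof (induction D)
  case (Edge e)
  then show ?case by (simp add: alt_sum_def false_sets_def Pow_insert)
next
  case (Series D1 D2)
  have disj: "spd_edges D1 \<inter> spd_edges D2 = {}" using Series.prems by simp
  have "alt_sum (spd_edges D1 \<union> spd_edges D2) (false_sets D1 \<inter> false_sets D2) =
      alt_sum (spd_edges D1) (false_sets D1) * alt_sum (spd_edges D2) (false_sets D2)"
    by (rule alt_sum_mult[OF spd_edges_finite spd_edges_finite disj false_sets_local false_sets_local])
  moreover have "false_sets (Series D1 D2) = false_sets D1 \<inter> false_sets D2"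
    by (simp add: false_sets_def)
  ultimately have "alt_sum (spd_edges (Series D1 D2)) (false_sets (Series D1 D2)) =
      alt_sum (spd_edges D1) (false_sets D1) * alt_sum (spd_edges D2) (false_sets D2)"
    by simp
  then show ?case using Series by auto
next
  case (Parallel D1 D2)
  let ?E = "spd_edges D1" and ?F = "spd_edges D2" and ?A = "false_sets D1" and ?B = "false_sets D2"
  have disj: "?E \<inter> ?F = {}" using Parallel.prems by simp
  note mult = alt_sum_mult[OF spd_edges_finite spd_edges_finite disj]
  \<comment> \<open>Intersecting with \<open>UNIV\<close> brings a condition on one part alone into
    the shape of the product rule.\<close>
  have "alt_sum (?E \<union> ?F) (?A \<inter> UNIV) = alt_sum ?E ?A * alt_sum ?F UNIV"
    by (rule mult[OF false_sets_local]) simp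
  moreover have "alt_sum (?E \<union> ?F) (UNIV \<inter> ?B) = alt_sum ?E UNIV * alt_sum ?F ?B"
    by (rule mult[OF _ false_sets_local]) simp
  moreover have "alt_sum (?E \<union> ?F) (?A \<inter> ?B) = alt_sum ?E ?A * alt_sum ?F ?B"
    by (rule mult[OF false_sets_local false_sets_local])
  moreover have "alt_sum ?E UNIV = 0" "alt_sum ?F UNIV = 0"
    by (rule alt_sum_UNIV[OF spd_edges_finite spd_edges_nonempty])+
  ultimately have "alt_sum (?E \<union> ?F) (?A \<union> ?B) = - (alt_sum ?E ?A * alt_sum ?F ?B)"
    by (simp add: alt_sum_Un)
  moreover have "false_sets (Parallel D1 D2) = ?A \<union> ?B" by (simp add: false_sets_def)
  ultimately show ?case using Parallel by auto
qed

section \<open>Floral vertices\<close>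

lemma floral_simps:
  "floral (Series D1 D2) s = floral D1 s \<inter> floral D2 s"
  "floral (Parallel D1 D2) s = floral D1 s \<union> floral D2 s"
  by (simp_all add: floral_def)

lemma sign_vec_in_floral_Edge:
  assumes "is_sign s" "is_sign t"
  shows "sign_vec t \<in> floral (Edge e) s \<longleftrightarrow> t e = s e"
proof
  assume "sign_vec t \<in> floral (Edge e) s"
  then obtain x where x: "0 \<le> x $ e" "sign_vec t = s e *\<^sub>R x"
    by (auto simp: floral_def pos_halfspace_def)
  have "t e = sign_vec t $ e" by simp
  also have "\<dots> = s e * x $ e" unfolding x(2) by simp
  finally have "t e = s e * x $ e" .
  then show "t e = s e"
    using x(1) is_sign_cases[OF assms(1), of e] is_sign_cases[OF assms(2), of e] by auto
next
  assume "t e = s e"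
  moreover have "s e * s e = 1" using is_sign_cases[OF assms(1), of e] by auto
  ultimately show "sign_vec t \<in> floral (Edge e) s"
    unfolding floral_def pos_halfspace_def
    by (auto intro!: image_eqI[of _ _ "s e *\<^sub>R sign_vec t"])
qed

lemma sign_vec_in_floral:
  assumes "is_sign s" "is_sign t"
  shows "sign_vec t \<in> floral D s \<longleftrightarrow> {i. t i \<noteq> s i} \<in> false_sets D"
proof (induction D)
  case (Edge e)
  then show ?case using sign_vec_in_floral_Edge[OF assms] by (simp add: false_sets_def)
qed (auto simp: floral_simps false_sets_def)

lemma floral_local:
  assumes "is_sign s" "is_sign t" "is_sign t'" "\<And>i. i \<in> spd_edges D \<Longrightarrow> t i = t' i"
  shows "sign_vec t \<in> floral D s \<longleftrightarrow> sign_vec t' \<in> floral D s"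
proof -
  have "{i. t i \<noteq> s i} \<inter> spd_edges D = {i. t' i \<noteq> s i} \<inter> spd_edges D" using assms(4) by auto
  then show ?thesis
    unfolding sign_vec_in_floral[OF assms(1,2)] sign_vec_in_floral[OF assms(1,3)]
    by (metis false_sets_local)
qed

text \<open>Fixing the sign of i to e makes a second coordinate j inessential, so the link on that
  side has count zero. The value e is existential because it depends on whether i is joined to its
  sibling in series or in parallel.\<close>

definition kills :: "'n::finite set \<Rightarrow> 'n \<Rightarrow> (real^'n) set \<Rightarrow> bool" where
  "kills E i A \<longleftrightarrow> (\<exists>e j. (e = 1 \<or> e = -1) \<and> j \<in> E \<and> j \<noteq> i \<and>
    (\<forall>t. is_sign t \<longrightarrow> t i = e \<longrightarrow> (sign_vec (t(j := - t j)) \<in> A \<longleftrightarrow> sign_vec t \<in> A)))"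

text \<open>The killing value of \<open>i\<close> is the one that trivialises the sibling of \<open>i\<close>.\<close>

lemma kills_connection:
  fixes D1 D2 :: "'n::finite spd"
  assumes s: "is_sign s" and i: "i \<in> spd_edges D1" and disj: "spd_edges D1 \<inter> spd_edges D2 = {}"
    and D1: "D1 = Edge i \<or> kills (spd_edges D1) i (floral D1 s)"
  shows "kills (spd_edges D1 \<union> spd_edges D2) i (floral D1 s \<inter> floral D2 s)"
    and "kills (spd_edges D1 \<union> spd_edges D2) i (floral D1 s \<union> floral D2 s)"
proof -
  have flip: "is_sign (t(j := - t j))" if "is_sign t" for t :: "'n \<Rightarrow> real" and j
    using that by (auto simp: is_sign_def)
  have "kills (spd_edges D1 \<union> spd_edges D2) i (floral D1 s \<inter> floral D2 s) \<and>
     kills (spd_edges D1 \<union> spd_edges D2) i (floral D1 s \<union> floral D2 s)"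
  proof (cases "D1 = Edge i")
    case True
    \<comment> \<open>Any edge j of the sibling serves. The value \<open>- s i\<close> falsifies the
      edge i and excludes everything from the intersection; the value \<open>s i\<close> satisfies
      it and admits everything to the union.\<close>
    obtain j where j: "j \<in> spd_edges D2" "j \<noteq> i"
      using spd_edges_nonempty[of D2] i disj by blast
    have mem: "sign_vec t \<in> floral D1 s \<longleftrightarrow> t i = s i" if "is_sign t" for t
      unfolding True by (rule sign_vec_in_floral_Edge[OF s that])
    have mem': "sign_vec (t(j := - t j)) \<in> floral D1 s \<longleftrightarrow> t i = s i" if "is_sign t" for t
      unfolding mem[OF flip[OF that]] using j(2) by simp
    have e: "s i = 1 \<or> s i = -1" "- s i = 1 \<or> - s i = -1" "s i \<noteq> 0"
      using is_sign_cases[OF s, of i] by auto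
    show ?thesis
      unfolding kills_def
    proof (intro conjI)
      show "\<exists>e j. (e = 1 \<or> e = -1) \<and> j \<in> spd_edges D1 \<union> spd_edges D2 \<and> j \<noteq> i \<and>
        (\<forall>t. is_sign t \<longrightarrow> t i = e \<longrightarrow>
          (sign_vec (t(j := - t j)) \<in> floral D1 s \<inter> floral D2 s \<longleftrightarrow>
           sign_vec t \<in> floral D1 s \<inter> floral D2 s))"
        using e j mem mem' by (intro exI[of _ "- s i"] exI[of _ j]) (auto simp del: fun_upd_apply)
      show "\<exists>e j. (e = 1 \<or> e = -1) \<and> j \<in> spd_edges D1 \<union> spd_edges D2 \<and> j \<noteq> i \<and>
        (\<forall>t. is_sign t \<longrightarrow> t i = e \<longrightarrow>
          (sign_vec (t(j := - t j)) \<in> floral D1 s \<union> floral D2 s \<longleftrightarrow>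
           sign_vec t \<in> floral D1 s \<union> floral D2 s))"
        using e j mem mem' by (intro exI[of _ "s i"] exI[of _ j]) (auto simp del: fun_upd_apply)
    qed
  next
    case False
    then obtain e j where j: "e = 1 \<or> e = -1" "j \<in> spd_edges D1" "j \<noteq> i"
      "\<And>t. is_sign t \<Longrightarrow> t i = e \<Longrightarrow>
        (sign_vec (t(j := - t j)) \<in> floral D1 s \<longleftrightarrow> sign_vec t \<in> floral D1 s)"
      using D1 unfolding kills_def by blast
    \<comment> \<open>A killing inside \<open>D1\<close> survives the connection, since
      \<open>D2\<close> does not contain j.\<close>
    have "sign_vec (t(j := - t j)) \<in> floral D2 s \<longleftrightarrow> sign_vec t \<in> floral D2 s" if "is_sign t" for t
      using j(2) disj by (intro floral_local[OF s flip[OF that] that]) auto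
    then show ?thesis
      unfolding kills_def using j
      by (intro conjI exI[of _ e] exI[of _ j]) (simp_all del: fun_upd_apply)
  qed
  then show "kills (spd_edges D1 \<union> spd_edges D2) i (floral D1 s \<inter> floral D2 s)"
    and "kills (spd_edges D1 \<union> spd_edges D2) i (floral D1 s \<union> floral D2 s)" by blast+
qed

text \<open>A lone edge has no sibling to trivialise; it is the base of the induction and, for
  diagrams on all coordinates, the one-dimensional case.\<close>

lemma floral_kills:
  assumes "is_spd D" "i \<in> spd_edges D" "is_sign s"
  shows "D = Edge i \<or> kills (spd_edges D) i (floral D s)"
  using assms(1,2)
proof (induction D)
  case (Series D1 D2)
  consider "i \<in> spd_edges D1" | "i \<in> spd_edges D2" using Series.prems by auto
  then show ?case
  proof cases
    case 1
    then show ?thesis using Series kills_connection(1)[OF assms(3), of i D1 D2]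
      by (simp add: floral_simps)
  next
    case 2
    then show ?thesis using Series kills_connection(1)[OF assms(3), of i D2 D1]
      by (simp add: floral_simps Int_commute Un_commute)
  qed
next
  case (Parallel D1 D2)
  consider "i \<in> spd_edges D1" | "i \<in> spd_edges D2" using Parallel.prems by auto
  then show ?case
  proof cases
    case 1
    then show ?thesis using Parallel kills_connection(2)[OF assms(3), of i D1 D2]
      by (simp add: floral_simps)
  next
    case 2
    then show ?thesis using Parallel kills_connection(2)[OF assms(3), of i D2 D1]
      by (simp add: floral_simps Int_commute Un_commute)
  qed
qed simp

text \<open>Reversing s on X matches the sets in \<open>false_sets D\<close> with the sign vectors
  of the floral vertex, and multiplies the product of signs by \<open>(-1) ^ card X\<close>. So the
  count is the alternating sum of the diagram up to sign.\<close>

lemma signed_count_floral: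
  assumes "is_spd D" "spd_edges D = UNIV" "is_sign (s :: 'n::finite \<Rightarrow> real)"
  shows "signed_count {t. is_sign t \<and> sign_vec t \<in> floral D s} \<noteq> 0"
proof -
  let ?m = "\<lambda>X. (\<lambda>i. if i \<in> X then - s i else s i)"
  let ?S = "{t. is_sign t \<and> sign_vec t \<in> floral D s}"
  have s0: "s i \<noteq> 0" "s i \<noteq> - s i" "- s i \<noteq> s i" for i
    using is_sign_cases[OF assms(3), of i] by auto
  have m: "is_sign (?m X)" "{i. ?m X i \<noteq> s i} = X" for X
    using assms(3) s0 by (auto simp: is_sign_def)
  have prod_m: "(\<Prod>i\<in>UNIV. ?m X i) = (\<Prod>i\<in>UNIV. s i) * (-1) ^ card X" for X
  proof -
    have "(\<Prod>i\<in>UNIV. ?m X i) = (\<Prod>i\<in>UNIV. s i * (if i \<in> X then -1 else 1))"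
      by (rule prod.cong) auto
    also have "\<dots> = (\<Prod>i\<in>UNIV. s i) * (\<Prod>i\<in>UNIV. if i \<in> X then -1 else 1)"
      by (rule prod.distrib)
    also have "(\<Prod>i\<in>UNIV. if i \<in> X then -1 else 1) = (-1 :: real) ^ card X"
      by (simp add: prod.If_cases)
    finally show ?thesis .
  qed
  have "signed_count ?S = (\<Sum>X\<in>false_sets D. (\<Prod>i\<in>UNIV. s i) * (-1) ^ card X)"
    unfolding signed_count_def
  proof (rule sum.reindex_bij_witness[of _ ?m "\<lambda>t. {i. t i \<noteq> s i}"])
    fix t assume t: "t \<in> ?S"
    have "t i = - s i" if "t i \<noteq> s i" for i
      using that is_sign_cases[OF assms(3), of i] is_sign_cases[of t i] t by auto
    then show tm: "?m {i. t i \<noteq> s i} = t" by auto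
    show "{i. t i \<noteq> s i} \<in> false_sets D" using t sign_vec_in_floral[OF assms(3)] by auto
    show "(\<Prod>i\<in>UNIV. s i) * (-1) ^ card {i. t i \<noteq> s i} = (\<Prod>i\<in>UNIV. t i)"
      using prod_m[of "{i. t i \<noteq> s i}"] unfolding tm by simp
  next
    fix X assume "X \<in> false_sets D"
    then show "?m X \<in> ?S" using sign_vec_in_floral[OF assms(3) m(1), of X D] m by auto
    show "{i. ?m X i \<noteq> s i} = X" by (rule m(2))
  qed
  also have "\<dots> = (\<Prod>i\<in>UNIV. s i) * (\<Sum>X\<in>false_sets D. (-1) ^ card X)"
    by (rule sum_distrib_left[symmetric])
  also have "(\<Sum>X\<in>false_sets D. (-1) ^ card X) = real_of_int (alt_sum UNIV (false_sets D))"
    by (simp add: alt_sum_def sum.If_cases of_int_sum)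
  finally show ?thesis
    using alt_sum_false_sets[OF assms(1)] s0(1) by (auto simp: assms(2))
qed

text \<open>By \<open>germ_on_ray\<close> this describes the points just off the vertex: a nonempty
  germ places them in P, and i as sole inessential coordinate places them on an edge.\<close>

definition edge_direction :: "('n::finite \<Rightarrow> real) set \<Rightarrow> 'n \<Rightarrow> real \<Rightarrow> bool" where
  "edge_direction S i e \<longleftrightarrow> restrict_sign i e S \<noteq> {} \<and> inessential (restrict_sign i e S) = {i}"

text \<open>One sign of coordinate i is killed and contributes zero. As the total count is nonzero,
  the other link has nonzero count, which rules out an inessential coordinate besides i.\<close>

lemma floral_edge_direction:
  fixes A :: "(real^'n) set"
  assumes "floral_vertex A"
  defines "S \<equiv> {t. is_sign t \<and> sign_vec t \<in> A}"
  shows "signed_count S \<noteq> 0"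
    and "\<exists>e. (e = 1 \<or> e = -1) \<and> edge_direction S i e \<and> \<not> edge_direction S i (- e) \<and>
      link_count i (restrict_sign i (- e) S) = 0"
proof -
  obtain D s where D: "is_spd D" "spd_edges D = UNIV" "is_sign s" "A = floral D s"
    using assms(1) by (auto simp: floral_vertex_def)
  show nz: "signed_count S \<noteq> 0"
    unfolding S_def D(4) by (rule signed_count_floral[OF D(1-3)])
  have sgn: "S \<subseteq> {s. is_sign s}" by (auto simp: S_def)
  have rsgn: "restrict_sign i e S \<subseteq> {s. is_sign s}" for e by (auto simp: restrict_sign_def)
  have flip: "is_sign (t(j := - t j))" if "is_sign t" for t :: "'n \<Rightarrow> real" and j
    using that by (auto simp: is_sign_def)
  \<comment> \<open>Here e is the killed sign, so the edge points in direction \<open>- e\<close>.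
    The restriction is empty when the diagram is a single edge.\<close>
  obtain e where e: "e = 1 \<or> e = -1"
    "restrict_sign i e S = {} \<or> (\<exists>j. j \<noteq> i \<and> j \<in> inessential (restrict_sign i e S))"
  proof (cases "D = Edge i")
    case True
    have "restrict_sign i (- s i) S = {}"
      using is_sign_cases[OF D(3), of i] sign_vec_in_floral_Edge[OF D(3)]
      by (auto simp: restrict_sign_def S_def D(4) True)
    moreover have "- s i = 1 \<or> - s i = -1" using is_sign_cases[OF D(3), of i] by auto
    ultimately show ?thesis using that by blast
  next
    case False
    then have "kills UNIV i A" using floral_kills[OF D(1) _ D(3), of i] D(2,4) by simp
    then obtain e j where j: "e = 1 \<or> e = -1" "j \<noteq> i"
      "\<And>t. is_sign t \<Longrightarrow> t i = e \<Longrightarrow> (sign_vec (t(j := - t j)) \<in> A \<longleftrightarrow> sign_vec t \<in> A)"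
      unfolding kills_def by blast
    have "t(j := - t j) \<in> restrict_sign i e S \<longleftrightarrow> t \<in> restrict_sign i e S" if t: "is_sign t" for t
    proof -
      have u: "is_sign (t(i := e))" by (rule is_sign_upd[OF t j(1)])
      have "t(j := - t j, i := e) = (t(i := e))(j := - (t(i := e)) j)"
        using j(2) by (auto simp: fun_eq_iff)
      then show ?thesis
        using j(3)[OF u] u flip[OF u, of j] t flip[OF t, of j]
        by (simp only: restrict_sign_def S_def mem_Collect_eq fun_upd_same simp_thms)
    qed
    then have "j \<in> inessential (restrict_sign i e S)" by (simp add: inessential_def)
    then show ?thesis using that j by blast
  qed
  have zero: "link_count i (restrict_sign i e S) = 0"
    using e(2) link_count_empty link_count_inessential[OF rsgn] by metis
  then have nz': "link_count i (restrict_sign i (- e) S) \<noteq> 0"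
    using nz signed_count_link_count[OF sgn, of i] e(1) by auto
  have "- e = 1 \<or> - e = -1" using e(1) by auto
  then have "i \<in> inessential (restrict_sign i (- e) S)"
    using inessential_restrict_sign[of "- e" S i] by blast
  moreover have "j = i" if "j \<in> inessential (restrict_sign i (- e) S)" for j
    using nz' link_count_inessential[OF rsgn that] by blast
  moreover have "restrict_sign i (- e) S \<noteq> {}" using nz' by (auto simp: link_count_empty)
  ultimately have "edge_direction S i (- e)" unfolding edge_direction_def by auto
  moreover have "\<not> edge_direction S i (- (- e))"
    using e(2) unfolding edge_direction_def by auto
  ultimately show "\<exists>e. (e = 1 \<or> e = -1) \<and> edge_direction S i e \<and> \<not> edge_direction S i (- e) \<and>
      link_count i (restrict_sign i (- e) S) = 0"
    using zero \<open>- e = 1 \<or> - e = -1\<close> by (intro exI[of _ "- e"]) simp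
qed

section \<open>Edges\<close>

lemma axis_add: "axis i (x + y) = axis i x + (axis i y :: 'a::ab_group_add ^'n)"
  by (simp add: vec_eq_iff axis_def)

text \<open>Follow the edge until the germ first changes, at parameter c. Looking back from there,
  the link is still the germ of w, so only i could be inessential; if it were, the germ would not
  have changed.\<close>

lemma ray_to_vertex:
  fixes P :: "(real^'n) set"
  assumes P: "orthogonal_polytope P" and w: "w \<in> P" "inessential (germ P w) = {i}"
    and e: "e = 1 \<or> e = -1"
  shows "\<exists>c>0. w + axis i (e * c) \<in> vertices P \<and>
    restrict_sign i (- e) (germ P (w + axis i (e * c))) = germ P w \<and>
    (\<forall>s. 0 \<le> s \<longrightarrow> s < c \<longrightarrow> germ P (w + axis i (e * s)) = germ P w)"
proof -
  define ray where "ray s = w + axis i (e * s)" for s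
  define Z where "Z = {s. 0 \<le> s \<and> germ P (ray s) \<noteq> germ P w}"
  define c where "c = Inf Z"
  have e': "- e = 1 \<or> - e = -1" "e * e = 1" using e by auto
  have ray_shift: "ray x = ray s + axis i (e * (x - s))" for x s
    by (simp add: ray_def add.assoc axis_add[symmetric] right_diff_distrib)
  have ray_shift': "ray x = ray s + axis i ((- e) * (s - x))" for x s
    using ray_shift[of x s] by (simp add: right_diff_distrib)
  have ray0: "ray 0 = w" by (simp add: ray_def axis_def vec_eq_iff)
  have sgn: "germ P u \<subseteq> {s. is_sign s}" for u using germ_is_sign by auto
  have nearby: "\<exists>r>0. \<forall>x. \<bar>x - s\<bar> < r \<longrightarrow> germ P (ray x) = germ P w" if s: "germ P (ray s) = germ P w" for s
  proof -
    obtain r where r: "0 < r" "\<And>i e c. e = 1 \<or> e = -1 \<Longrightarrow> 0 < c \<Longrightarrow> c < r \<Longrightarrow>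
        germ P (ray s + axis i (e * c)) = restrict_sign i e (germ P (ray s))"
      using germ_on_ray[OF P, of "ray s"] by blast
    have res: "restrict_sign i e (germ P w) = germ P w" if "e = 1 \<or> e = -1" for e
      using w(2) sgn that by (intro restrict_sign_inessential) auto
    have "germ P (ray x) = germ P w" if x: "\<bar>x - s\<bar> < r" for x
    proof (cases x s rule: linorder_cases)
      case less
      then show ?thesis using r(2)[OF e'(1), of "s - x" i] x res[OF e'(1)] s
        unfolding ray_shift'[of x s] by simp
    next
      case greater
      then show ?thesis using r(2)[OF e, of "x - s" i] x res[OF e] s
        unfolding ray_shift[of x s] by simp
    qed (simp add: s)
    then show ?thesis using r(1) by blast
  qed
  have "Z \<noteq> {}"
  proof
    assume "Z = {}"
    then have inP: "ray s \<in> P" if "0 \<le> s" for s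
      using that w(1) germ_empty_iff[OF P] unfolding Z_def by blast
    obtain K where K: "\<And>x. x \<in> P \<Longrightarrow> norm x \<le> K"
      using compact_imp_bounded[OF orthogonal_polytope_compact[OF P]] bounded_iff by metis
    have K0: "0 \<le> K" using K[OF w(1)] norm_ge_zero order_trans by blast
    \<comment> \<open>Large enough that coordinate i of the ray has absolute value at least K + 1,
      for either sign e.\<close>
    define s where "s = K + \<bar>w $ i\<bar> + 1"
    have "\<bar>ray s $ i\<bar> \<le> K"
      using inP[of s] K0 K[of "ray s"] component_le_norm_cart[of "ray s" i] by (simp add: s_def)
    moreover have "ray s $ i = w $ i + e * s" by (simp add: ray_def)
    ultimately show False using e unfolding s_def by auto
  qed
  have bdd: "bdd_below Z" by (auto simp: Z_def)
  have before: "germ P (ray s) = germ P w" if "0 \<le> s" "s < c" for s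
    using that cInf_lower[OF _ bdd, of s] unfolding c_def Z_def by force
  have "0 < c"
  proof -
    obtain r where r: "0 < r" "\<And>x. \<bar>x - 0\<bar> < r \<Longrightarrow> germ P (ray x) = germ P w"
      using nearby[of 0] ray0 by auto
    have "r \<le> z" if "z \<in> Z" for z using r(2)[of z] that by (force simp: Z_def)
    then show ?thesis using cInf_greatest[OF \<open>Z \<noteq> {}\<close>] r(1) unfolding c_def by fastforce
  qed
  \<comment> \<open>Otherwise the germ would stay constant beyond c, and the infimum would be at
    least c + r.\<close>
  have at_c: "germ P (ray c) \<noteq> germ P w"
  proof
    assume "germ P (ray c) = germ P w"
    then obtain r where r: "0 < r" "\<And>x. \<bar>x - c\<bar> < r \<Longrightarrow> germ P (ray x) = germ P w"
      using nearby by blast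
    have "c + r \<le> z" if z: "z \<in> Z" for z
      using r(2)[of z] z cInf_lower[OF z bdd] unfolding c_def[symmetric] by (force simp: Z_def)
    then show False using cInf_greatest[OF \<open>Z \<noteq> {}\<close>] r(1) unfolding c_def by fastforce
  qed
  obtain r where r: "0 < r" "\<And>i e x. e = 1 \<or> e = -1 \<Longrightarrow> 0 < x \<Longrightarrow> x < r \<Longrightarrow>
      germ P (ray c + axis i (e * x)) = restrict_sign i e (germ P (ray c))"
    using germ_on_ray[OF P, of "ray c"] by blast
  \<comment> \<open>A point shortly before c: close enough to \<open>ray c\<close> for the ray
    formula, and not before w.\<close>
  define s where "s = c - min r c / 2"
  have s: "0 \<le> s" "s < c" "c - s < r" "0 < c - s"
    using r(1) \<open>0 < c\<close> unfolding s_def by (auto simp: min_def)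
  have opposite: "restrict_sign i (- e) (germ P (ray c)) = germ P w"
    using r(2)[OF e'(1) s(4,3), of i] before[OF s(1,2)] ray_shift'[of s c] by simp
  have "inessential (germ P (ray c)) \<subseteq> {i}"
    using inessential_restrict_sign[OF e'(1), of "germ P (ray c)" i] w(2) unfolding opposite by blast
  moreover have "i \<notin> inessential (germ P (ray c))"
    using restrict_sign_inessential[OF _ sgn e'(1)] opposite at_c by metis
  ultimately have "inessential (germ P (ray c)) = {}" by blast
  moreover have "ray c \<in> P"
  proof (rule ccontr)
    assume "ray c \<notin> P"
    then have "germ P (ray c) = {}" using germ_empty_iff[OF P] by blast
    then have "germ P w = {}" using opposite by (simp add: restrict_sign_def)
    then show False using germ_empty_iff[OF P] w(1) by blast
  qed
  ultimately have "ray c \<in> vertices P" using vertices_eq[OF P] by blast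
  then show ?thesis using \<open>0 < c\<close> opposite before unfolding ray_def by blast
qed

lemma open_segment_along_axis:
  fixes w :: "real^'n"
  assumes "x < y"
  shows "open_segment (w + axis i x) (w + axis i y) = (\<lambda>t. w + axis i t) ` {x<..<y}"
proof -
  have lin: "linear (axis i :: real \<Rightarrow> real^'n)"
    by (rule linearI) (auto simp: vec_eq_iff axis_def)
  have "inj (axis i :: real \<Rightarrow> real^'n)" by (auto simp: inj_on_def axis_eq_axis)
  then have "open_segment (axis i x) (axis i y) = (axis i :: real \<Rightarrow> real^'n) ` open_segment x y"
    using open_segment_linear_image[OF lin] by blast
  then show ?thesis
    using assms by (simp add: open_segment_translation_eq[symmetric] image_image
        open_segment_eq_real_ivl open_segment_translation)
qed

text \<open>The two rays from w end in vertices. The region is connected and lies on the line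
  through w, so passing an end would mean containing that vertex, whose germ has no inessential
  coordinate.\<close>

lemma genericity_region_edge:
  fixes P :: "(real^'n) set"
  assumes P: "orthogonal_polytope P" and w: "w \<in> P" "inessential (germ P w) = {i}"
  obtains \<alpha> \<beta> where "0 < \<alpha>" "0 < \<beta>"
    "w + axis i (- \<alpha>) \<in> vertices P" "w + axis i \<beta> \<in> vertices P"
    "restrict_sign i 1 (germ P (w + axis i (- \<alpha>))) = germ P w"
    "restrict_sign i (-1) (germ P (w + axis i \<beta>)) = germ P w"
    "genericity_region P w = open_segment (w + axis i (- \<alpha>)) (w + axis i \<beta>)"
proof -
  obtain \<beta> where \<beta>: "0 < \<beta>" "w + axis i \<beta> \<in> vertices P"
    "restrict_sign i (- 1) (germ P (w + axis i \<beta>)) = germ P w"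
    "\<And>s. 0 \<le> s \<Longrightarrow> s < \<beta> \<Longrightarrow> germ P (w + axis i s) = germ P w"
    using ray_to_vertex[OF P w, of 1] by auto
  obtain \<alpha> where \<alpha>: "0 < \<alpha>" "w + axis i (- \<alpha>) \<in> vertices P"
    "restrict_sign i 1 (germ P (w + axis i (- \<alpha>))) = germ P w"
    "\<And>s. 0 \<le> s \<Longrightarrow> s < \<alpha> \<Longrightarrow> germ P (w + axis i (- s)) = germ P w"
    using ray_to_vertex[OF P w, of "-1"] by auto
  have const: "germ P (w + axis i s) = germ P w" if "- \<alpha> < s" "s < \<beta>" for s
    using \<alpha>(4)[of "- s"] \<beta>(4)[of s] that by (cases "0 \<le> s") auto
  have line: "z = w + axis i (z $ i - w $ i)" if "z \<in> genericity_region P w" for z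
    using genericity_region_flat(2)[OF P w(1) that] w(2) by (auto simp: vec_eq_iff axis_def)
  have conn: "connected (genericity_region P w)"
    unfolding genericity_region_eq[OF P w(1)] by (simp add: path_connected_imp_connected)
  have w_mem: "w \<in> genericity_region P w"
    unfolding genericity_region_eq[OF P w(1)] by (simp add: path_component_refl)
  have avoid: "w + axis i s \<notin> genericity_region P w" if "w + axis i s \<in> vertices P" for s
    using that vertices_eq[OF P] genericity_region_flat(1)[OF P w(1)] w(2)
    by (metis insert_not_empty)
  have "genericity_region P w = (\<lambda>t. w + axis i t) ` {- \<alpha><..<\<beta>}"
  proof
    show "genericity_region P w \<subseteq> (\<lambda>t. w + axis i t) ` {- \<alpha><..<\<beta>}"
    proof
      fix z assume z: "z \<in> genericity_region P w"
      have "z $ i - w $ i < \<beta>"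
      proof (rule ccontr)
        assume "\<not> z $ i - w $ i < \<beta>"
        then obtain u where u: "u \<in> genericity_region P w" "u $ i = w $ i + \<beta>"
          using connected_ivt_component_cart[OF conn w_mem z, of i "w $ i + \<beta>"] \<beta>(1) by auto
        then show False using line[OF u(1)] avoid[OF \<beta>(2)] by simp
      qed
      moreover have "- \<alpha> < z $ i - w $ i"
      proof (rule ccontr)
        assume "\<not> - \<alpha> < z $ i - w $ i"
        then obtain u where u: "u \<in> genericity_region P w" "u $ i = w $ i - \<alpha>"
          using connected_ivt_component_cart[OF conn z w_mem, of i "w $ i - \<alpha>"] \<alpha>(1) by auto
        then show False using line[OF u(1)] avoid[OF \<alpha>(2)] by simp
      qed
      ultimately show "z \<in> (\<lambda>t. w + axis i t) ` {- \<alpha><..<\<beta>}"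
        using line[OF z] by (intro image_eqI[where x = "z $ i - w $ i"]) simp_all
    qed
    show "(\<lambda>t. w + axis i t) ` {- \<alpha><..<\<beta>} \<subseteq> genericity_region P w"
    proof
      fix z assume "z \<in> (\<lambda>t. w + axis i t) ` {- \<alpha><..<\<beta>}"
      then obtain t where t: "- \<alpha> < t" "t < \<beta>" "z = w + axis i t" by auto
      have "closed_segment w z \<subseteq> {u. germ P u = germ P w}"
      proof
        fix u assume "u \<in> closed_segment w z"
        then obtain x where x: "0 \<le> x" "x \<le> 1" "u = w + axis i (x * t)"
          unfolding t(3) by (rule segment_along_axis)
        define q where "q = x * t"
        have "q \<in> closed_segment 0 t"
          using x by (auto simp: in_segment q_def)
        then have "- \<alpha> < q" "q < \<beta>"
          using t \<alpha>(1) \<beta>(1) by (auto simp: closed_segment_eq_real_ivl split: if_splits)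
        then show "u \<in> {u. germ P u = germ P w}" using const x(3) by (simp add: q_def)
      qed
      then show "z \<in> genericity_region P w"
        unfolding genericity_region_eq[OF P w(1)] using segment_path_component by blast
    qed
  qed
  then have "genericity_region P w = open_segment (w + axis i (- \<alpha>)) (w + axis i \<beta>)"
    using \<alpha>(1) \<beta>(1) by (simp add: open_segment_along_axis)
  then show thesis using that \<alpha>(1-3) \<beta>(1-3) by blast
qed

section \<open>One-dimensional faces as segments between vertices\<close>

lemma endpoints_closed_segment:
  fixes a b :: "real^'n"
  assumes "a \<noteq> b"
  shows "endpoints (closed_segment a b) = {a, b}"
  using assms by (auto simp: endpoints_def doubleton_eq_iff)

lemma genericity_region_cong:
  assumes P: "orthogonal_polytope P" and "v \<in> P" and "u \<in> genericity_region P v"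
  shows "genericity_region P u = genericity_region P v"
proof -
  have g: "germ P u = germ P v" by (rule genericity_region_flat(1)[OF assms])
  then have "u \<in> P" using germ_empty_iff[OF P] assms(2) by blast
  then show ?thesis
    using assms(3) path_component_eq
    unfolding genericity_region_eq[OF P assms(2)] genericity_region_eq[OF P \<open>u \<in> P\<close>] g by blast
qed

lemma faces_1_iff:
  fixes P :: "(real^'n) set"
  assumes "orthogonal_polytope P"
  shows "F \<in> faces 1 P \<longleftrightarrow>
    (\<exists>w i. w \<in> P \<and> inessential (germ P w) = {i} \<and> F = closure (genericity_region P w))"
  using region_degree_eq[OF assms] by (auto simp: faces_def card_1_singleton_iff)

text \<open>The edge is oriented so that a is its lower end in coordinate i. Both ends restrict to
  the germ of the interior points, which yields the edge directions 1 and -1 and the common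
  link.\<close>

lemma face_segment:
  fixes P :: "(real^'n) set"
  assumes P: "orthogonal_polytope P" and F: "F \<in> faces 1 P"
  obtains a i c where "0 < c" "a \<in> vertices P" "a + axis i c \<in> vertices P"
    "F = closed_segment a (a + axis i c)" "endpoints F = {a, a + axis i c}"
    "edge_direction (germ P a) i 1" "edge_direction (germ P (a + axis i c)) i (-1)"
    "restrict_sign i 1 (germ P a) = restrict_sign i (-1) (germ P (a + axis i c))"
    "\<And>x. 0 < x \<Longrightarrow> x < c \<Longrightarrow> F = closure (genericity_region P (a + axis i x))"
proof -
  obtain w i where w: "w \<in> P" "inessential (germ P w) = {i}" "F = closure (genericity_region P w)"
    using F faces_1_iff[OF P] by blast
  obtain \<alpha> \<beta> where ab: "0 < \<alpha>" "0 < \<beta>"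
    "w + axis i (- \<alpha>) \<in> vertices P" "w + axis i \<beta> \<in> vertices P"
    "restrict_sign i 1 (germ P (w + axis i (- \<alpha>))) = germ P w"
    "restrict_sign i (-1) (germ P (w + axis i \<beta>)) = germ P w"
    "genericity_region P w = open_segment (w + axis i (- \<alpha>)) (w + axis i \<beta>)"
    using genericity_region_edge[OF P w(1,2)] by blast
  define a where "a = w + axis i (- \<alpha>)"
  define c where "c = \<alpha> + \<beta>"
  have shift: "a + axis i x = w + axis i (x - \<alpha>)" for x
    by (simp add: a_def add.assoc axis_add[symmetric])
  have b: "a + axis i c = w + axis i \<beta>" by (simp add: shift c_def)
  have c: "0 < c" using ab by (simp add: c_def)
  then have ne: "a \<noteq> a + axis i c" by (simp add: axis_eq_0_iff)
  have F_eq: "F = closed_segment a (a + axis i c)"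
    using ne unfolding w(3) ab(7) b a_def[symmetric] by simp
  have w_ne: "germ P w \<noteq> {}" using w(1) germ_empty_iff[OF P] by blast
  show thesis
  proof (rule that[of c a i])
    show "endpoints F = {a, a + axis i c}" unfolding F_eq by (rule endpoints_closed_segment[OF ne])
    show "F = closure (genericity_region P (a + axis i x))" if "0 < x" "x < c" for x
    proof -
      have "a + axis i x \<in> genericity_region P w"
        using that ab(1,2) unfolding ab(7) shift by (auto simp: open_segment_along_axis c_def)
      then show ?thesis using genericity_region_cong[OF P w(1)] w(3) by simp
    qed
    show "a + axis i c \<in> vertices P" unfolding b by (rule ab(4))
    show "edge_direction (germ P (a + axis i c)) i (-1)"
      unfolding edge_direction_def b ab(6) using w_ne w(2) by blast
    show "restrict_sign i 1 (germ P a) = restrict_sign i (-1) (germ P (a + axis i c))"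
      unfolding b ab(6) unfolding a_def ab(5) ..
  qed (use c ab(3,5) F_eq w_ne w(2) in \<open>auto simp: a_def edge_direction_def\<close>)
qed

text \<open>Points of the short ray share one germ and hence one region. The vertex v is a limit of
  this open segment but has a different germ, so it is an endpoint. The radius r is a parameter so
  that one value can serve all directions at v.\<close>

lemma incident_region:
  fixes P :: "(real^'n) set"
  assumes P: "orthogonal_polytope P" and v: "v \<in> vertices P" and e: "e = 1 \<or> e = -1"
    and dir: "edge_direction (germ P v) i e"
    and ray_all: "\<forall>c. 0 < c \<longrightarrow> c < r \<longrightarrow> germ P (v + axis i (e * c)) = restrict_sign i e (germ P v)"
    and x: "0 < x" "x < r"
  shows "v + axis i (e * x) \<in> P" and "inessential (germ P (v + axis i (e * x))) = {i}"
    and "\<And>c. 0 < c \<Longrightarrow> c < r \<Longrightarrow>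
      genericity_region P (v + axis i (e * c)) = genericity_region P (v + axis i (e * x))"
    and "v \<in> endpoints (closure (genericity_region P (v + axis i (e * x))))"
proof -
  let ?w = "v + axis i (e * x)"
  note ray = ray_all[rule_format]
  show wP: "?w \<in> P" and iness: "inessential (germ P ?w) = {i}"
    using dir ray[OF x] germ_empty_iff[OF P] unfolding edge_direction_def by auto
  have mem: "v + axis i (e * c) \<in> genericity_region P ?w" if c: "0 < c" "c < r" for c
  proof -
    have "closed_segment ?w (v + axis i (e * c)) \<subseteq> {u. germ P u = germ P ?w}"
    proof
      fix u assume u: "u \<in> closed_segment ?w (v + axis i (e * c))"
      have "v + axis i (e * c) = ?w + axis i (e * (c - x))"
        by (simp add: add.assoc axis_add[symmetric] right_diff_distrib)
      with u obtain y where y: "0 \<le> y" "y \<le> 1" "u = ?w + axis i (y * (e * (c - x)))"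
        using segment_along_axis by metis
      have u: "u = v + axis i (e * ((1 - y) * x + y * c))"
        unfolding y(3) by (simp add: add.assoc axis_add[symmetric] algebra_simps)
      have "(1 - y) * x + y * c \<in> closed_segment x c"
        using y by (auto simp: in_segment)
      then have "0 < (1 - y) * x + y * c" "(1 - y) * x + y * c < r"
        using x c by (auto simp: closed_segment_eq_real_ivl split: if_splits)
      then show "u \<in> {u. germ P u = germ P ?w}" unfolding u using ray ray[OF x] by simp
    qed
    then show ?thesis
      unfolding genericity_region_eq[OF P wP] using segment_path_component by blast
  qed
  show "genericity_region P (v + axis i (e * c)) = genericity_region P ?w" if "0 < c" "c < r" for c
    using genericity_region_cong[OF P wP mem[OF that]] .
  have "v \<in> closure (genericity_region P ?w)"
    unfolding closure_approachable
  proof (intro allI impI)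
    fix \<epsilon> :: real assume "0 < \<epsilon>"
    define c where "c = min \<epsilon> r / 2"
    have c: "0 < c" "c < r" "c < \<epsilon>" using \<open>0 < \<epsilon>\<close> x by (auto simp: c_def min_def)
    have "dist (v + axis i (e * c)) v = c"
      using e c(1) by (auto simp: dist_norm norm_eq_sqrt_inner inner_axis_axis)
    then show "\<exists>y\<in>genericity_region P ?w. dist y v < \<epsilon>"
      using mem[OF c(1,2)] c(3) by (intro bexI[of _ "v + axis i (e * c)"]) simp_all
  qed
  moreover have "v \<notin> genericity_region P ?w"
    using genericity_region_flat(1)[OF P wP] iness v vertices_eq[OF P] by (metis insert_not_empty)
  moreover obtain a b where ab: "genericity_region P ?w = open_segment a b"
    using genericity_region_edge[OF P wP iness] by metis
  ultimately have "a \<noteq> b" "v \<in> closed_segment a b" "v \<notin> open_segment a b"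
    by (auto split: if_splits)
  then show "v \<in> endpoints (closure (genericity_region P ?w))"
    unfolding ab closure_open_segment by (auto simp: endpoints_closed_segment open_segment_def)
qed

section \<open>Vertex degrees and the two-colouring\<close>

lemma face_in_line:
  fixes P :: "(real^'n) set"
  assumes P: "orthogonal_polytope P" and w: "w \<in> P" "inessential (germ P w) = {i}"
    and "z \<in> closure (genericity_region P w)" "k \<noteq> i"
  shows "z $ k = w $ k"
proof -
  have "closed {z :: real^'n. z $ k = w $ k}"
    by (intro closed_Collect_eq continuous_intros)
  moreover have "genericity_region P w \<subseteq> {z. z $ k = w $ k}"
    using genericity_region_flat(2)[OF P w(1)] w(2) \<open>k \<noteq> i\<close> by auto
  ultimately show ?thesis using closure_minimal assms(4) by blast
qed

text \<open>Sending coordinate i to the face in its unique edge direction is a bijection onto the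
  incident faces. It is injective because the faces lie on lines along different axes, and
  surjective because an incident face induces an edge direction at v.\<close>

lemma generic_vertex_degree:
  fixes P :: "(real^'n) set"
  assumes P: "orthogonal_polytope P" and v: "v \<in> vertices P"
    and fl: "floral_vertex (tangent_cone P v)"
  shows "vertex_degree (faces 1 P) endpoints v = CARD('n)"
proof -
  have "\<forall>i. \<exists>e. (e = 1 \<or> e = -1) \<and> edge_direction (germ P v) i e \<and>
      \<not> edge_direction (germ P v) i (- e)"
    using floral_edge_direction(2)[OF fl] unfolding germ_def by blast
  then obtain d where d: "\<And>i. d i = 1 \<or> d i = -1" "\<And>i. edge_direction (germ P v) i (d i)"
    "\<And>i. \<not> edge_direction (germ P v) i (- d i)"
    by metis
  obtain r where r: "0 < r" "\<And>i e c. e = 1 \<or> e = -1 \<Longrightarrow> 0 < c \<Longrightarrow> c < r \<Longrightarrow>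
      germ P (v + axis i (e * c)) = restrict_sign i e (germ P v)"
    using germ_on_ray[OF P, of v] by blast
  define w where "w i = v + axis i (d i * (r/2))" for i
  define f where "f i = closure (genericity_region P (w i))" for i
  have r2: "0 < r/2" "r/2 < r" using r(1) by auto
  have ray: "\<forall>c. 0 < c \<longrightarrow> c < r \<longrightarrow>
      germ P (v + axis i (d i * c)) = restrict_sign i (d i) (germ P v)" for i
    using r(2)[OF d(1)] by blast
  note inc = incident_region[OF P v d(1) d(2) ray r2]
  have wP: "w i \<in> P" "inessential (germ P (w i)) = {i}" for i
    unfolding w_def using inc(1,2) by blast+
  have "inj f"
  proof (rule injI, rule ccontr)
    fix i j assume fij: "f i = f j" and "i \<noteq> j"
    have "w i \<in> genericity_region P (w i)"
      unfolding genericity_region_eq[OF P wP(1)] by (simp add: path_component_refl)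
    then have "w i \<in> closure (genericity_region P (w j))"
      using fij closure_subset unfolding f_def by blast
    then have "w i $ i = w j $ i" using face_in_line[OF P wP(1,2)] \<open>i \<noteq> j\<close> by blast
    moreover have "w i $ i = v $ i + d i * (r/2)" "w j $ i = v $ i"
      using \<open>i \<noteq> j\<close> by (simp_all add: w_def axis_def)
    ultimately show False using d(1)[of i] r(1) by auto
  qed
  have "{F \<in> faces 1 P. v \<in> endpoints F} = range f"
  proof
    show "range f \<subseteq> {F \<in> faces 1 P. v \<in> endpoints F}"
      using inc(4) faces_1_iff[OF P] wP unfolding f_def w_def by blast
    show "{F \<in> faces 1 P. v \<in> endpoints F} \<subseteq> range f"
    proof
      fix F assume "F \<in> {F \<in> faces 1 P. v \<in> endpoints F}"
      then have F: "F \<in> faces 1 P" "v \<in> endpoints F" by auto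
      obtain a i c where ac: "0 < c" "endpoints F = {a, a + axis i c}"
        "edge_direction (germ P a) i 1" "edge_direction (germ P (a + axis i c)) i (-1)"
        "\<And>x. 0 < x \<Longrightarrow> x < c \<Longrightarrow> F = closure (genericity_region P (a + axis i x))"
        using face_segment[OF P F(1)] by metis
      \<comment> \<open>Whether v is the lower or the upper end, the face is reparametrised from v
        outwards.\<close>
      have "\<exists>e. (e = 1 \<or> e = -1) \<and> edge_direction (germ P v) i e \<and>
        (\<forall>x. 0 < x \<longrightarrow> x < c \<longrightarrow> F = closure (genericity_region P (v + axis i (e * x))))"
      proof (cases "v = a")
        case True
        then show ?thesis using ac(3,5) by (intro exI[of _ 1]) auto
      next
        case False
        then have va: "v = a + axis i c" using F(2) ac(2) by auto
        have "v + axis i (-1 * x) = a + axis i (c - x)" for x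
          unfolding va by (simp add: add.assoc axis_add[symmetric])
        then have "F = closure (genericity_region P (v + axis i (-1 * x)))" if "0 < x" "x < c" for x
          using ac(5)[of "c - x"] that by (metis diff_gt_0_iff_gt diff_less_eq less_add_same_cancel1)
        then show ?thesis using ac(4)[folded va] by (intro exI[of _ "-1"]) blast
      qed
      then obtain e where e: "e = 1 \<or> e = -1" "edge_direction (germ P v) i e"
        "\<And>x. 0 < x \<Longrightarrow> x < c \<Longrightarrow> F = closure (genericity_region P (v + axis i (e * x)))"
        by blast
      have ed: "e = d i" using e(1,2) d(1)[of i] d(3)[of i] by auto
      \<comment> \<open>Small enough to lie both on the face F and on the short ray that defines
        \<open>f i\<close>, so the two regions coincide.\<close>
      define x where "x = min c r / 2"
      have x: "0 < x" "x < c" "x < r" using ac(1) r(1) by (auto simp: x_def min_def)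
      have "F = f i" unfolding f_def w_def using e(3)[OF x(1,2)] inc(3)[OF x(1,3)] ed by metis
      then show "F \<in> range f" by blast
    qed
  qed
  then show ?thesis using \<open>inj f\<close> by (simp add: vertex_degree_def card_image)
qed

text \<open>The edge direction along i is unique, so the link on the side \<open>- e\<close> counts
  zero and only the term of sign e remains in the splitting.\<close>

lemma signed_count_edge_direction:
  fixes A :: "(real^'n) set"
  assumes "floral_vertex A" "S = {t. is_sign t \<and> sign_vec t \<in> A}"
    and "e = 1 \<or> e = -1" "edge_direction S i e"
  shows "signed_count S = e * link_count i (restrict_sign i e S)" "signed_count S \<noteq> 0"
proof -
  obtain e' where e': "e' = 1 \<or> e' = -1" "\<not> edge_direction S i (- e')"
      "link_count i (restrict_sign i (- e') S) = 0"
    using floral_edge_direction(2)[OF assms(1), of i] unfolding assms(2) by blast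
  have "e' = e" using e'(1,2) assms(3,4) by auto
  moreover have "S \<subseteq> {s. is_sign s}" using assms(2) by auto
  ultimately show "signed_count S = e * link_count i (restrict_sign i e S)"
    using signed_count_link_count[of S i] e'(3) assms(3) by auto
  show "signed_count S \<noteq> 0" using floral_edge_direction(1)[OF assms(1)] assms(2) by simp
qed

theorem proposition4p4:
  fixes P :: "(real^'n) set"
  assumes "generic_orthotope P"
  shows "simple_graph (vertices P) (faces 1 P) endpoints
       \<and> bipartite (vertices P) (faces 1 P) endpoints
       \<and> (\<forall>v\<in>vertices P. vertex_degree (faces 1 P) endpoints v = CARD('n))"
proof (intro conjI ballI)
  have P: "orthogonal_polytope P" and fl: "\<And>v. v \<in> vertices P \<Longrightarrow> floral_vertex (tangent_cone P v)"
    using assms by (auto simp: generic_orthotope_def)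
  show "vertex_degree (faces 1 P) endpoints v = CARD('n)" if "v \<in> vertices P" for v
    by (rule generic_vertex_degree[OF P that fl[OF that]])
  show "simple_graph (vertices P) (faces 1 P) endpoints"
    unfolding simple_graph_def
  proof (intro conjI ballI inj_onI)
    fix F assume F: "F \<in> faces 1 P"
    obtain a i c where ac: "0 < c" "a \<in> vertices P" "a + axis i c \<in> vertices P"
      "endpoints F = {a, a + axis i c}"
      using face_segment[OF P F] by metis
    then show "endpoints F \<subseteq> vertices P" by simp
    have "a \<noteq> a + axis i c" using ac(1) by (simp add: axis_eq_0_iff)
    then show "card (endpoints F) = 2" unfolding ac(4) by simp
  next
    fix F G assume F: "F \<in> faces 1 P" and G: "G \<in> faces 1 P" and eq: "endpoints F = endpoints G"
    obtain a b where "F = closed_segment a b" "endpoints F = {a, b}"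
      using face_segment[OF P F] by metis
    moreover obtain a' b' where "G = closed_segment a' b'" "endpoints G = {a', b'}"
      using face_segment[OF P G] by metis
    ultimately show "F = G" using eq by simp
  qed
  \<comment> \<open>The colour of a vertex is the sign of its count, which floral vertices never let
    vanish.\<close>
  let ?A = "{v \<in> vertices P. 0 < signed_count (germ P v)}"
  let ?B = "{v \<in> vertices P. signed_count (germ P v) < 0}"
  show "bipartite (vertices P) (faces 1 P) endpoints"
    unfolding bipartite_def
  proof (rule exI[of _ ?A], rule exI[of _ ?B], intro conjI ballI)
    show "?A \<union> ?B = vertices P"
      using floral_edge_direction(1)[OF fl] unfolding germ_def[symmetric]
      by (auto simp: not_less_iff_gr_or_eq neq_iff)
    show "?A \<inter> ?B = {}" by auto
    fix F assume F: "F \<in> faces 1 P"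
    obtain a i c where ac: "a \<in> vertices P" "a + axis i c \<in> vertices P"
      "endpoints F = {a, a + axis i c}"
      "edge_direction (germ P a) i 1" "edge_direction (germ P (a + axis i c)) i (-1)"
      "restrict_sign i 1 (germ P a) = restrict_sign i (-1) (germ P (a + axis i c))"
      using face_segment[OF P F] by metis
    let ?b = "a + axis i c"
    note a = signed_count_edge_direction[OF fl[OF ac(1)] germ_def _ ac(4)]
    note b = signed_count_edge_direction[OF fl[OF ac(2)] germ_def _ ac(5)]
    \<comment> \<open>The two ends have the same link but reach it in directions 1 and -1, so their
      counts are opposite.\<close>
    have opposite: "signed_count (germ P ?b) = - signed_count (germ P a)" "signed_count (germ P a) \<noteq> 0"
      using a b ac(6) by auto
    show "\<exists>x\<in>?A. \<exists>y\<in>?B. endpoints F = {x, y}"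
    proof (cases "0 < signed_count (germ P a)")
      case True
      then show ?thesis using opposite ac(1,2,3) by (intro bexI[of _ a] bexI[of _ ?b]) auto
    next
      case False
      then show ?thesis using opposite ac(1,2,3) by (intro bexI[of _ ?b] bexI[of _ a]) auto
    qed
  qed
qed

end
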